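(* Let $d\ge 4$, $\mathcal D=\{1,\ldots,d\}$, and let $\mathbf X=(X_1,\ldots,X_d)$ have standard exponential margins and joint density $f$ given by a $d$-dimensional $D$-vine (nodes labelled in path order $1,2,\ldots,d$) in which every pair copula is an inverted extreme value copula, the pair copula for the edge $\{i,j\mid i+1,\ldots,j-1\}$ having exponent measure $V^{\{i,j\mid i+1,\ldots,j-1\}}$. For a set $\mathcal C\subseteq\mathcal D$ of consecutive indices let $g_{\mathcal C}$ denote the gauge function of the corresponding sub-vine density $f_{\mathcal C}$ of $\mathbf X_{\mathcal C}$, and write $g=g_{\mathcal D}$. Then the gauge function of $f$ is given by $$g(\mathbf x)=g_{\mathcal D\setminus\{1,d\}}(\mathbf x_{-\{1,d\}})+V^{\{1,d\mid\mathcal D\setminus\{1,d\}\}}\left\{\frac{1}{g_{\mathcal D\setminus\{d\}}(\mathbf x_{-\{d\}})-g_{\mathcal D\setminus\{1,d\}}(\mathbf x_{-\{1,d\}})},\ \frac{1}{g_{\mathcal D\setminus\{1\}}(\mathbf x_{-\{1\}})-g_{\mathcal D\setminus\{1,d\}}(\mathbf x_{-\{1,d\}})}\right\},$$ for $x_i\ge 0$, $i=1,\ldots,d$.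
   Context: Notation: $\mathbf x_{\mathcal C}=(x_i:i\in\mathcal C)$ and $\mathbf x_{-\mathcal C}=(x_i:i\in\mathcal D\setminus\mathcal C)$. The gauge function of a density $f_{\mathcal C}$ (standard exponential margins) is the function $g_{\mathcal C}$, homogeneous of order 1, with $-\ln f_{\mathcal C}(t\mathbf x_{\mathcal C})\sim t g_{\mathcal C}(\mathbf x_{\mathcal C})$ as $t\to\infty$. Exponent measure: $V(x,y)=2\int_0^1\max\left(\frac wx,\frac{1-w}{y}\right)dH(w)$, $x,y>0$, where the spectral distribution $H$ is a probability distribution on $[0,1]$ with $\int_0^1 w\,dH(w)=1/2$. The derivatives $V_1,V_2,V_{12}$ of $V$ with respect to the first, second and both arguments are assumed to exist. Where a coordinate or a difference of gauge functions is $0$, its reciprocal is read as $\infty$ and $V$ is evaluated by the same integral (with $w/\infty=(1-w)/\infty=0$). Inverted extreme value copula with exponent measure $V$: $C(u,v)=u+v-1+\exp\left[-V\left\{\frac{-1}{\ln(1-u)},\frac{-1}{\ln(1-v)}\right\}\right]$, with density $c=\partial^2C/\partial u\,\partial v$. $D$-vine density: for $i<j$ put $S_{ij}=\{i+1,\ldots,j-1\}$ and let $C_{ij|S_{ij}}$ be the pair copula (not depending on the values of the conditioning variables) with density $c_{ij|S_{ij}}$ and exponent measure $V^{\{i,j\mid S_{ij}\}}$. Marginally $F_i(x)=1-e^{-x}$, $f_i(x)=e^{-x}$, and recursively $$F_{i|S_{ij}\cup\{j\}}=\partial_2C_{ij|S_{ij}}\left(F_{i|S_{ij}},F_{j|S_{ij}}\right),\qquad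 F_{j|S_{ij}\cup\{i\}}=\partial_1C_{ij|S_{ij}}\left(F_{i|S_{ij}},F_{j|S_{ij}}\right),$$ where $F_{k|S}=F_{k|S}(x_k\mid\mathbf x_S)$ and $F_{k|\emptyset}=F_k$. Then $$f(\mathbf x)=\prod_{i=1}^d f_i(x_i)\prod_{1\le i<j\le d}c_{ij|S_{ij}}\left\{F_{i|S_{ij}}(x_i\mid\mathbf x_{S_{ij}}),F_{j|S_{ij}}(x_j\mid\mathbf x_{S_{ij}})\right\}.$$ For a block $\mathcal C$ of consecutive indices, the sub-vine density $f_{\mathcal C}$ is the same product restricted to indices in $\mathcal C$ (it is the marginal density of $\mathbf X_{\mathcal C}$). *)

theory Defs
  imports "HOL-Probability.Probability" "HOL-Library.Landau_Symbols"
begin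

definition spectral_distribution :: "real measure \<Rightarrow> bool" where
  "spectral_distribution H \<longleftrightarrow>
     prob_space H \<and> sets H = sets borel \<and> (AE w in H. w \<in> {0..1}) \<and> (\<integral>w. w \<partial>H) = 1 / 2"

text \<open>
  The arguments range over the positive reals and infinity, and infinity is encoded by the
  real number 0: as division by 0 yields 0 in HOL, the reciprocal of 0 is 0, and dividing
  w or 1 - w by it gives 0, which is the convention required for an infinite argument.
\<close>

definition exponent_measure :: "real measure \<Rightarrow> real \<Rightarrow> real \<Rightarrow> real" where
  "exponent_measure H x y = 2 * (\<integral>w. max (w / x) ((1 - w) / y) \<partial>H)"

definition partial1 :: "(real \<Rightarrow> real \<Rightarrow> real) \<Rightarrow> real \<Rightarrow> real \<Rightarrow> real" where
  "partial1 F x y = deriv (\<lambda>x'. F x' y) x"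

definition partial2 :: "(real \<Rightarrow> real \<Rightarrow> real) \<Rightarrow> real \<Rightarrow> real \<Rightarrow> real" where
  "partial2 F x y = deriv (\<lambda>y'. F x y') y"

definition partial12_exist :: "(real \<Rightarrow> real \<Rightarrow> real) \<Rightarrow> bool" where
  "partial12_exist V \<longleftrightarrow> (\<forall>x>0. \<forall>y>0.
     (\<lambda>x'. V x' y) differentiable (at x) \<and>
     (\<lambda>y'. V x y') differentiable (at y) \<and>
     (\<lambda>x'. partial2 V x' y) differentiable (at x))"

definition inverted_ev_copula :: "(real \<Rightarrow> real \<Rightarrow> real) \<Rightarrow> real \<Rightarrow> real \<Rightarrow> real" where
  "inverted_ev_copula V u v = u + v - 1 + exp (- V (-1 / ln (1 - u)) (-1 / ln (1 - v)))"

definition copula_density :: "(real \<Rightarrow> real \<Rightarrow> real) \<Rightarrow> real \<Rightarrow> real \<Rightarrow> real" where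
  "copula_density C = partial1 (partial2 C)"

text \<open>
  A D-vine is given by the spectral distributions of its edges: for i < j, the edge
  with conditioned pair i, j and conditioning set S = {i+1..j-1} has spectral distribution
  H i j.
\<close>

definition pair_copula :: "(nat \<Rightarrow> nat \<Rightarrow> real measure) \<Rightarrow> nat \<Rightarrow> nat \<Rightarrow> real \<Rightarrow> real \<Rightarrow> real" where
  "pair_copula H i j = inverted_ev_copula (exponent_measure (H i j))"

text \<open>
  For i < j, the conditional distribution functions of coordinates i and j, respectively,
  given the coordinates in {i+1..j-1}, all evaluated at x. In the first recursion the last
  element j-1 of the conditioning set is the one added to {i+1..j-2}; in the second it is
  the first element i+1 that is added to {i+2..j-1}.
\<close>

function cond_cdf_left cond_cdf_right ::
  "(nat \<Rightarrow> nat \<Rightarrow> real measure) \<Rightarrow> (nat \<Rightarrow> real) \<Rightarrow> nat \<Rightarrow> nat \<Rightarrow> real" where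
  "cond_cdf_left H x i j =
     (if j \<le> i + 1 then 1 - exp (- x i)
      else partial2 (pair_copula H i (j - 1))
             (cond_cdf_left H x i (j - 1)) (cond_cdf_right H x i (j - 1)))"
| "cond_cdf_right H x i j =
     (if j \<le> i + 1 then 1 - exp (- x j)
      else partial1 (pair_copula H (i + 1) j)
             (cond_cdf_left H x (i + 1) j) (cond_cdf_right H x (i + 1) j))"
  by pat_completeness auto
termination
  by (relation "Wellfounded.measure (\<lambda>p. case p of Inl (H, x, i, j) \<Rightarrow> j - i | Inr (H, x, i, j) \<Rightarrow> j - i)") auto

declare cond_cdf_left.simps [simp del] cond_cdf_right.simps [simp del]

definition dvine_density ::
  "(nat \<Rightarrow> nat \<Rightarrow> real measure) \<Rightarrow> nat set \<Rightarrow> (nat \<Rightarrow> real) \<Rightarrow> real" where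
  "dvine_density H C x =
     (\<Prod>i\<in>C. exp (- x i)) *
     (\<Prod>(i, j)\<in>{(i, j). i \<in> C \<and> j \<in> C \<and> i < j}.
        copula_density (pair_copula H i j) (cond_cdf_left H x i j) (cond_cdf_right H x i j))"

text \<open>
  Vectors indexed by C are the functions that are undefined outside C. The asymptotic relation
  is required on the open orthant, where f is determined by the vine; on its boundary
  the density may vanish or be singular (for the inverted logistic copula it vanishes on the
  coordinate axes), and the gauge function is the continuous extension. Positivity of f is
  stated explicitly because ln 0 = 0 in HOL.
\<close>

definition gauge_function ::
  "nat set \<Rightarrow> ((nat \<Rightarrow> real) \<Rightarrow> real) \<Rightarrow> ((nat \<Rightarrow> real) \<Rightarrow> real) \<Rightarrow> bool" where
  "gauge_function C f g \<longleftrightarrow>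
     (\<forall>x \<in> C \<rightarrow>\<^sub>E {0..}. \<forall>t>0. g (\<lambda>i\<in>C. t * x i) = t * g x) \<and>
     continuous_on (C \<rightarrow>\<^sub>E {0..}) g \<and>
     (\<forall>x \<in> C \<rightarrow>\<^sub>E {0<..}.
        (\<forall>\<^sub>F t in at_top. f (\<lambda>i\<in>C. t * x i) > 0) \<and>
        (\<lambda>t. - ln (f (\<lambda>i\<in>C. t * x i))) \<sim>[at_top] (\<lambda>t. t * g x))"

end

theory Submission
  imports Defs
begin

text \<open>
  In the exponential coordinates a = -ln (1 - u) and b = -ln (1 - v) an exponent measure V
  becomes the convex, 1-homogeneous function A(a, b) = V(1/a, 1/b) = b \<rho>(a/b), with \<rho> depending on
  one variable only. With \<kappa> = \<rho>', \<tau> = \<rho> - s \<kappa> and s = a/b, so that \<kappa> and \<tau> are the two partial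
  derivatives of A, the conditional survival functions of the pair copula are
  \<tau>(s) exp(b - A) and \<kappa>(s) exp(a - A), and its density is
  (\<kappa>(s) \<tau>(s) + s \<kappa>'(s) / b) exp(a + b - A).

  Suppose that along a ray t x the coordinates at the edge {i, j} grow like t \<alpha> and t \<beta>. If all the
  prefactors are exp(o(t)), the coordinates that this edge hands on to the next level grow like
  t (A(\<alpha>, \<beta>) - \<beta>) and t (A(\<alpha>, \<beta>) - \<alpha>), and minus the logarithm of the copula density grows like
  t (A(\<alpha>, \<beta>) - \<alpha> - \<beta>). The density of the block i..j is
  f(i..j-1) f(i+1..j) c / f(i+1..j-1), and inductively \<alpha> = g(i..j-1) - g(i+1..j-1) and
  \<beta> = g(i+1..j) - g(i+1..j-1); taking logarithms gives g(i..j) = g(i+1..j-1) + A(\<alpha>, \<beta>), which is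
  the claim and also carries the induction. What needs an argument are the prefactors.

  \<^item> \<kappa> and \<tau> have no zeros (slope_pos, intercept_pos). Both are monotone, so a zero of one of them makes
    the copula density vanish on a whole cone in the (a, b)-quadrant. Letting an outer coordinate of x
    grow moves the direction (\<alpha>, \<beta>) into that cone, so the vine density would vanish far out on
    a ray, where the gauge function requires it to be positive.

  \<^item> As \<kappa>' \<ge> 0, the density prefactor is at least \<kappa> \<tau>, which gives g(i..j) \<le> g(i+1..j-1) + A(\<alpha>, \<beta>)
    (block_gauge_le).

  \<^item> The converse (edge_gauge_le) is the delicate part, because \<kappa>' is only a derivative that exists
    everywhere: it may have arbitrarily high spikes, and on a single ray these could dominate. They
    cannot on average. The conditional density of coordinate i is the derivative in x_i of a
    distribution function, so its integral over all larger values is at most the survival function,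
    which is exp(-t (A(\<alpha>, \<beta>) - \<beta>) + o(t)). By Borel--Cantelli
    (derivatives_tend_to_zero_somewhere) the required bound holds at almost every nearby x_i along
    integer t, hence for the gauge function there, and by continuity of the gauge function at x.

  \<^item> If the existence of a gauge function of the full vine is replaced by a continuous positive copula
    density at the last edge, then \<kappa>' is continuous there, hence bounded along the ray
    (density_limit_of_continuous).
\<close>

section \<open>Exponent measures and Pickands functions\<close>

definition pickands :: "real measure \<Rightarrow> real \<Rightarrow> real" where
  "pickands H s = exponent_measure H (1 / s) 1"

abbreviation pickands_slope :: "real measure \<Rightarrow> real \<Rightarrow> real" where
  "pickands_slope H \<equiv> deriv (pickands H)"

text \<open>
  The tangent to the Pickands function at s meets the vertical axis at this height. It is also the
  partial derivative in b of A(a, b) = b * pickands H (a / b) at a / b = s; the partial derivative in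
  a is the slope of the tangent.
\<close>

definition pickands_intercept :: "real measure \<Rightarrow> real \<Rightarrow> real" where
  "pickands_intercept H s = pickands H s - s * pickands_slope H s"

text \<open>
  The copula density without its exponential factor. In terms of A it is the product of the two first
  partial derivatives minus the mixed one; as A is 1-homogeneous, the mixed one is homogeneous of
  order -1, which is why it comes with the factor 1 / b.
\<close>

definition density_factor :: "real measure \<Rightarrow> real \<Rightarrow> real \<Rightarrow> real" where
  "density_factor H s b =
     pickands_slope H s * pickands_intercept H s + s * deriv (pickands_slope H) s / b"

lemma pickands_eq: "pickands H s = 2 * (\<integral>w. max (w * s) (1 - w) \<partial>H)"
  by (simp add: pickands_def exponent_measure_def)

lemma exponent_measure_eq:
  "exponent_measure H (1 / a) (1 / b) = 2 * (\<integral>w. max (w * a) ((1 - w) * b) \<partial>H)"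
  by (simp add: exponent_measure_def)

lemma exponent_measure_homogeneous:
  assumes "0 \<le> t"
  shows "exponent_measure H (1 / (t * a)) (1 / (t * b)) = t * exponent_measure H (1 / a) (1 / b)"
proof -
  have "max (w * (t * a)) ((1 - w) * (t * b)) = t * max (w * a) ((1 - w) * b)" for w
    using assms by (simp add: max_mult_distrib_left mult_ac)
  then show ?thesis by (simp add: exponent_measure_eq)
qed

text \<open>
  Homogeneity reduces the exponent measure to a function of one variable. Mere existence of its partial
  derivatives thereby becomes differentiability on the half-line, once for the Pickands function and
  once for its slope; hence the first partial derivatives are continuous.
\<close>

lemma exponent_measure_pickands:
  assumes "0 < b"
  shows "exponent_measure H (1 / a) (1 / b) = b * pickands H (a / b)"
  using exponent_measure_homogeneous[of b H "a / b" 1] assms by (simp add: pickands_def)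

locale spectral_measure =
  fixes H :: "real measure"
  assumes spectral: "spectral_distribution H"
begin

sublocale prob_space H
  using spectral by (simp add: spectral_distribution_def)

lemma sets_H [measurable_cong]: "sets H = sets borel"
  using spectral by (simp add: spectral_distribution_def)

lemma AE_unit: "AE w in H. 0 \<le> w \<and> w \<le> 1"
  using spectral by (simp add: spectral_distribution_def)

lemma integrable_id: "integrable H (\<lambda>w. w)"
  by (rule integrable_const_bound[where B = 1]) (use AE_unit in auto)

lemma integrable_max: "integrable H (\<lambda>w. max (w * a) ((1 - w) * b))"
  by (intro integrable_max integrable_mult_left Bochner_Integration.integrable_diff
        integrable_id integrable_const)

lemma integral_id: "(\<integral>w. w \<partial>H) = 1 / 2"
  using spectral by (simp add: spectral_distribution_def)

lemma integral_linear: "(\<integral>w. w * a + (1 - w) * b \<partial>H) = (a + b) / 2"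
proof -
  have "(\<integral>w. w * a + (1 - w) * b \<partial>H) = (\<integral>w. w * a \<partial>H) + (\<integral>w. (1 - w) * b \<partial>H)"
    by (intro Bochner_Integration.integral_add integrable_mult_left
        Bochner_Integration.integrable_diff integrable_id integrable_const)
  also have "(\<integral>w. w * a \<partial>H) = (\<integral>w. w \<partial>H) * a"
    by simp
  also have "(\<integral>w. (1 - w) * b \<partial>H) = (\<integral>w. 1 - w \<partial>H) * b"
    by simp
  also have "(\<integral>w. 1 - w \<partial>H) = 1 - (\<integral>w. w \<partial>H)"
    using integrable_id by (simp add: prob_space)
  finally show ?thesis by (simp add: integral_id field_simps)
qed

text \<open>
  The bound holds for all real arguments, so continuity extends to the boundary of the
  orthant, where differences of gauge functions may vanish.
\<close>

lemma exponent_measure_lipschitz: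
  "\<bar>exponent_measure H (1 / a) (1 / b) - exponent_measure H (1 / a') (1 / b')\<bar>
     \<le> \<bar>a - a'\<bar> + \<bar>b - b'\<bar>"
proof -
  let ?m = "\<lambda>a b w. max (w * a) ((1 - w) * b)"
  have upper: "exponent_measure H (1 / a) (1 / b) \<le> exponent_measure H (1 / a') (1 / b')
      + (\<bar>a - a'\<bar> + \<bar>b - b'\<bar>)" for a b a' b'
  proof -
    have "(\<integral>w. ?m a b w \<partial>H) \<le> (\<integral>w. ?m a' b' w + (w * \<bar>a - a'\<bar> + (1 - w) * \<bar>b - b'\<bar>) \<partial>H)"
    proof (rule integral_mono_AE)
      show "AE w in H. ?m a b w \<le> ?m a' b' w + (w * \<bar>a - a'\<bar> + (1 - w) * \<bar>b - b'\<bar>)"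
        using AE_unit
      proof eventually_elim
        case (elim w)
        have "w * (a - a') \<le> w * \<bar>a - a'\<bar>" "(1 - w) * (b - b') \<le> (1 - w) * \<bar>b - b'\<bar>"
          "0 \<le> w * \<bar>a - a'\<bar>" "0 \<le> (1 - w) * \<bar>b - b'\<bar>"
          using elim by (auto intro!: mult_left_mono)
        then have "w * a \<le> w * a' + w * \<bar>a - a'\<bar>" "(1 - w) * b \<le> (1 - w) * b' + (1 - w) * \<bar>b - b'\<bar>"
          "0 \<le> w * \<bar>a - a'\<bar>" "0 \<le> (1 - w) * \<bar>b - b'\<bar>"
          by (simp_all add: right_diff_distrib)
        then show ?case by linarith
      qed
    qed (intro integrable_max Bochner_Integration.integrable_add integrable_mult_left
        Bochner_Integration.integrable_diff integrable_id integrable_const)+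
    also have "\<dots> = (\<integral>w. ?m a' b' w \<partial>H) + (\<integral>w. w * \<bar>a - a'\<bar> + (1 - w) * \<bar>b - b'\<bar> \<partial>H)"
      by (intro Bochner_Integration.integral_add integrable_max Bochner_Integration.integrable_add
          integrable_mult_left Bochner_Integration.integrable_diff integrable_id integrable_const)
    finally show ?thesis unfolding exponent_measure_eq integral_linear by argo
  qed
  show ?thesis
    using upper[of a b a' b'] upper[of a' b' a b] by (simp add: abs_minus_commute)
qed

lemma continuous_on_exponent_measure:
  assumes "continuous_on S a" "continuous_on S b"
  shows "continuous_on S (\<lambda>x. exponent_measure H (1 / a x) (1 / b x))"
proof (clarsimp simp: continuous_on_def)
  fix x assume "x \<in> S"
  then have "(a \<longlongrightarrow> a x) (at x within S)" "(b \<longlongrightarrow> b x) (at x within S)"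
    using assms by (auto simp: continuous_on_def)
  then have "((\<lambda>y. \<bar>a y - a x\<bar> + \<bar>b y - b x\<bar>) \<longlongrightarrow> \<bar>a x - a x\<bar> + \<bar>b x - b x\<bar>) (at x within S)"
    by (intro tendsto_intros)
  then have lim: "((\<lambda>y. \<bar>a y - a x\<bar> + \<bar>b y - b x\<bar>) \<longlongrightarrow> 0) (at x within S)"
    by simp
  have "((\<lambda>y. exponent_measure H (1 / a y) (1 / b y) - exponent_measure H (1 / a x) (1 / b x))
           \<longlongrightarrow> 0) (at x within S)"
    by (rule Lim_null_comparison[OF _ lim]) (simp add: exponent_measure_lipschitz)
  then show "((\<lambda>y. exponent_measure H (1 / a y) (1 / b y))
           \<longlongrightarrow> exponent_measure H (1 / a x) (1 / b x)) (at x within S)"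
    by (subst Lim_null)
qed

text \<open>
  The linear terms have known integrals because the spectral distribution has mean 1/2, so that
  inequalities between exponent measures and linear functions can be checked under the integral.
\<close>

lemma exponent_measure_mono:
  assumes "\<And>w. 0 \<le> w \<Longrightarrow> w \<le> 1 \<Longrightarrow>
      max (w * a) ((1 - w) * b) + (w * c + (1 - w) * d) \<le> max (w * a') ((1 - w) * b') + (w * c' + (1 - w) * d')"
  shows "exponent_measure H (1 / a) (1 / b) + (c + d) \<le> exponent_measure H (1 / a') (1 / b') + (c' + d')"
proof -
  have split: "(\<integral>w. max (w * a) ((1 - w) * b) + (w * c + (1 - w) * d) \<partial>H) =
      (\<integral>w. max (w * a) ((1 - w) * b) \<partial>H) + (c + d) / 2" for a b c d
    unfolding integral_linear[symmetric]
    by (intro Bochner_Integration.integral_add integrable_max Bochner_Integration.integrable_add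
        integrable_mult_left Bochner_Integration.integrable_diff integrable_id integrable_const)
  have "(\<integral>w. max (w * a) ((1 - w) * b) + (w * c + (1 - w) * d) \<partial>H) \<le>
     (\<integral>w. max (w * a') ((1 - w) * b') + (w * c' + (1 - w) * d') \<partial>H)"
  proof (rule integral_mono_AE)
    show "AE w in H. max (w * a) ((1 - w) * b) + (w * c + (1 - w) * d) \<le>
        max (w * a') ((1 - w) * b') + (w * c' + (1 - w) * d')"
      using AE_unit by eventually_elim (use assms in auto)
  qed (intro integrable_max Bochner_Integration.integrable_add integrable_mult_left
        Bochner_Integration.integrable_diff integrable_id integrable_const)+
  then show ?thesis unfolding split exponent_measure_eq by argo
qed

lemma pickands_ge: "1 \<le> pickands H s" "s \<le> pickands H s"
  using exponent_measure_mono[of 0 0 0 1 s 1 0 0] exponent_measure_mono[of 0 0 s 0 s 1 0 0]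
  by (simp_all add: pickands_def exponent_measure_def)

lemma pickands_0: "pickands H 0 = 1"
  using exponent_measure_mono[of 0 1 0 0 0 0 0 1] pickands_ge[of 0]
  by (simp add: pickands_def exponent_measure_def)

lemma convex_on_pickands: "convex_on UNIV (pickands H)"
proof (rule convex_onI)
  fix t x y :: real
  assume t: "0 < t" "t < 1"
  let ?m = "\<lambda>a w. max (w * a) (1 - w)"
  have int: "integrable H (?m a)" for a
    using integrable_max[of a 1] by simp
  have "(\<integral>w. ?m ((1 - t) * x + t * y) w \<partial>H) \<le> (\<integral>w. (1 - t) * ?m x w + t * ?m y w \<partial>H)"
  proof (rule integral_mono)
    fix w
    have "(1 - t) * (w * x) \<le> (1 - t) * ?m x w" "t * (w * y) \<le> t * ?m y w"
      "(1 - t) * (1 - w) \<le> (1 - t) * ?m x w" "t * (1 - w) \<le> t * ?m y w"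
      using t by (auto intro!: mult_left_mono)
    moreover have "w * ((1 - t) * x + t * y) = (1 - t) * (w * x) + t * (w * y)"
      "1 - w = (1 - t) * (1 - w) + t * (1 - w)"
      by (auto simp: algebra_simps)
    ultimately show "?m ((1 - t) * x + t * y) w \<le> (1 - t) * ?m x w + t * ?m y w"
      by linarith
  qed (intro int Bochner_Integration.integrable_add integrable_mult_right)+
  also have "\<dots> = (1 - t) * (\<integral>w. ?m x w \<partial>H) + t * (\<integral>w. ?m y w \<partial>H)"
    using int by simp
  finally show "pickands H ((1 - t) *\<^sub>R x + t *\<^sub>R y) \<le> (1 - t) * pickands H x + t * pickands H y"
    by (simp add: pickands_eq algebra_simps)
qed simp

lemma mono_pickands: "s \<le> s' \<Longrightarrow> pickands H s \<le> pickands H s'"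
  using exponent_measure_mono[of s 1 0 0 s' 1 0 0]
  by (simp add: pickands_def mult_left_mono max.coboundedI1)

lemma pickands_lipschitz: "s \<le> s' \<Longrightarrow> pickands H s' - s' \<le> pickands H s - s"
proof -
  assume "s \<le> s'"
  then have "w * s \<le> w * s'" if "0 \<le> w" for w
    using that by (simp add: mult_left_mono)
  then have "max (w * s') (1 - w) + w * s \<le> max (w * s) (1 - w) + w * s'" if "0 \<le> w" for w
    using that by (smt (verit))
  then show ?thesis
    using exponent_measure_mono[of s' 1 s 0 s 1 s' 0]
    by (simp add: pickands_def)
qed

lemma pickands_quotient_antimono:
  assumes "0 < s" "s \<le> s'"
  shows "pickands H s' / s' \<le> pickands H s / s"
proof -
  have eq: "pickands H r / r = exponent_measure H (1 / 1) (1 / (1 / r))" if "0 < r" for r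
    using exponent_measure_pickands[of "1 / r" H 1] that by simp
  have "(1 - w) * (1 / s') \<le> (1 - w) * (1 / s)" if "w \<le> 1" for w
    using that assms by (intro mult_left_mono) (auto simp: frac_le)
  then have "exponent_measure H (1 / 1) (1 / (1 / s')) + (0 + 0)
      \<le> exponent_measure H (1 / 1) (1 / (1 / s)) + (0 + 0)"
    by (intro exponent_measure_mono) (auto intro: max.coboundedI2)
  then show ?thesis using eq[of s] eq[of s'] assms by simp
qed

end

locale smooth_spectral_measure = spectral_measure +
  assumes derivs: "partial12_exist (exponent_measure H)"
begin

abbreviation "\<rho> \<equiv> pickands H"
abbreviation "\<kappa> \<equiv> pickands_slope H"
abbreviation "\<kappa>' \<equiv> deriv (pickands_slope H)"
abbreviation "\<tau> \<equiv> pickands_intercept H"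

lemma pickands_has_derivative:
  assumes "0 < s"
  shows "(\<rho> has_real_derivative \<kappa> s) (at s)"
proof -
  have "(\<lambda>x. exponent_measure H x 1) differentiable (at (1 / s))"
    using derivs assms by (auto simp: partial12_exist_def)
  then obtain D where "((\<lambda>x. exponent_measure H x 1) has_real_derivative D) (at (1 / s))"
    by (auto simp: real_differentiable_def)
  moreover have "((\<lambda>s. 1 / s) has_real_derivative (- 1 / s\<^sup>2)) (at s)"
    using assms by (auto intro!: derivative_eq_intros simp: power2_eq_square field_simps)
  ultimately have "((\<lambda>s. exponent_measure H (1 / s) 1) has_real_derivative D * (- 1 / s\<^sup>2)) (at s)"
    by (rule DERIV_chain2)
  then have "(\<rho> has_real_derivative D * (- 1 / s\<^sup>2)) (at s)"
    by (simp add: pickands_def[abs_def])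
  then show ?thesis by (metis DERIV_imp_deriv)
qed

text \<open>
  The mixed second derivative of the exponent measure is assumed to exist only in this order, second
  argument first. It yields a derivative of the intercept, and the slope is recovered from the
  intercept.
\<close>

lemma partial2_exponent_measure:
  assumes "0 < x"
  shows "partial2 (exponent_measure H) x 1 = - \<tau> (1 / x)"
proof -
  have ev: "\<forall>\<^sub>F y in nhds 1. exponent_measure H x y = 1 / y * \<rho> (y / x)"
  proof (rule eventually_mono)
    show "\<forall>\<^sub>F y in nhds 1. (y::real) \<in> {0<..}"
      by (rule eventually_nhds_in_open) auto
    show "exponent_measure H x y = 1 / y * \<rho> (y / x)" if "y \<in> {0<..}" for y
      using exponent_measure_pickands[of "1 / y" H "1 / x"] that by simp
  qed
  have "((\<lambda>y. y / x) has_real_derivative 1 / x) (at 1)"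
    using assms by (auto intro!: derivative_eq_intros)
  moreover have "(\<rho> has_real_derivative \<kappa> (1 / x)) (at (1 / x))"
    using assms by (intro pickands_has_derivative) simp
  ultimately have "((\<lambda>y. \<rho> (y / x)) has_real_derivative \<kappa> (1 / x) * (1 / x)) (at 1)"
    by (intro DERIV_chain2[where f = \<rho> and g = "\<lambda>y. y / x"])
  then have "((\<lambda>y. 1 / y * \<rho> (y / x)) has_real_derivative - \<tau> (1 / x)) (at 1)"
    by (auto intro!: derivative_eq_intros simp: pickands_intercept_def)
  then show ?thesis
    using DERIV_cong_ev[OF refl ev refl] by (simp add: partial2_def DERIV_imp_deriv)
qed

lemma slope_has_derivative:
  assumes "0 < s"
  shows "(\<kappa> has_real_derivative \<kappa>' s) (at s)"
proof -
  have "(\<lambda>x. partial2 (exponent_measure H) x 1) differentiable (at (1 / s))"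
    using derivs assms by (auto simp: partial12_exist_def)
  then obtain D where "((\<lambda>x. partial2 (exponent_measure H) x 1) has_real_derivative D) (at (1 / s))"
    by (auto simp: real_differentiable_def)
  moreover have "((\<lambda>s. 1 / s) has_real_derivative (- 1 / s\<^sup>2)) (at s)"
    using assms by (auto intro!: derivative_eq_intros simp: power2_eq_square field_simps)
  ultimately have V2: "((\<lambda>s. partial2 (exponent_measure H) (1 / s) 1) has_real_derivative D * (- 1 / s\<^sup>2)) (at s)"
    by (rule DERIV_chain2)
  have ev: "\<forall>\<^sub>F r in nhds s. \<kappa> r = (\<rho> r + partial2 (exponent_measure H) (1 / r) 1) / r"
    using eventually_nhds_in_open[of "{0<..}" s] assms
    by (auto elim!: eventually_mono simp: partial2_exponent_measure pickands_intercept_def)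
  have "\<exists>D. ((\<lambda>r. (\<rho> r + partial2 (exponent_measure H) (1 / r) 1) / r) has_real_derivative D) (at s)"
    using assms by (auto intro!: exI derivative_eq_intros V2 pickands_has_derivative)
  then obtain D' where "(\<kappa> has_real_derivative D') (at s)"
    using DERIV_cong_ev[OF refl ev refl] by auto
  then show ?thesis by (metis DERIV_imp_deriv)
qed

lemma intercept_has_derivative:
  assumes "0 < s"
  shows "(\<tau> has_real_derivative - s * \<kappa>' s) (at s)"
  unfolding pickands_intercept_def[abs_def] using assms
  by (auto intro!: derivative_eq_intros pickands_has_derivative slope_has_derivative)

lemma slope_nonneg:
  assumes "0 < s" shows "0 \<le> \<kappa> s"
  by (rule mono_on_imp_deriv_nonneg[OF _ pickands_has_derivative[OF assms], of UNIV])
    (auto intro: mono_onI mono_pickands)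

lemma slope_le_1:
  assumes "0 < s" shows "\<kappa> s \<le> 1"
proof -
  have "((\<lambda>s. s - \<rho> s) has_real_derivative 1 - \<kappa> s) (at s)"
    using assms by (auto intro!: derivative_eq_intros pickands_has_derivative)
  moreover have "mono_on UNIV (\<lambda>s. s - \<rho> s)"
    by (intro mono_onI) (use pickands_lipschitz in force)
  ultimately have "0 \<le> 1 - \<kappa> s"
    by (intro mono_on_imp_deriv_nonneg[of UNIV "\<lambda>s. s - \<rho> s" _ s]) auto
  then show ?thesis by simp
qed

lemma tangent_below:
  assumes "0 < s" shows "\<rho> s + \<kappa> s * (r - s) \<le> \<rho> r"
  using convex_on_imp_above_tangent[OF convex_on_pickands, of s r "\<kappa> s"]
    pickands_has_derivative[OF assms] by simp

lemma intercept_le_1: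
  assumes "0 < s" shows "\<tau> s \<le> 1"
  using tangent_below[OF assms, of 0] by (simp add: pickands_intercept_def pickands_0 mult.commute)

lemma quotient_has_derivative:
  assumes "0 < s"
  shows "((\<lambda>s. \<rho> s / s) has_real_derivative - \<tau> s / s\<^sup>2) (at s)"
proof -
  have "((\<lambda>s. \<rho> s / s) has_real_derivative (\<kappa> s * s - \<rho> s * 1) / (s * s)) (at s)"
    using assms by (intro DERIV_divide pickands_has_derivative DERIV_ident) auto
  then show ?thesis by (simp add: pickands_intercept_def power2_eq_square mult.commute)
qed

text \<open>
  The quotient of the Pickands function by s equals A(1, 1 / s), hence is decreasing in s, and its
  derivative is minus the intercept over s^2.
\<close>

lemma intercept_nonneg:
  assumes "0 < s" shows "0 \<le> \<tau> s"
proof -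
  have "((\<lambda>s. - (\<rho> s / s)) has_real_derivative \<tau> s / s\<^sup>2) (at s)"
    using DERIV_minus[OF quotient_has_derivative[OF assms]] by simp
  moreover have "mono_on {0<..} (\<lambda>s. - (\<rho> s / s))"
    using pickands_quotient_antimono by (intro mono_onI) auto
  ultimately have "0 \<le> \<tau> s / s\<^sup>2"
    using assms by (intro mono_on_imp_deriv_nonneg[of "{0<..}" "\<lambda>s. - (\<rho> s / s)" _ s])
      (auto simp: interior_open)
  then show ?thesis using assms by (simp add: zero_le_divide_iff)
qed

lemma slope_mono:
  assumes "0 < s" "s \<le> r" shows "\<kappa> s \<le> \<kappa> r"
proof (cases "s = r")
  case False
  then have "\<kappa> s * (r - s) \<le> \<kappa> r * (r - s)"
    using tangent_below[of s r] tangent_below[of r s] assms by (simp add: algebra_simps)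
  then show ?thesis using assms False by simp
qed simp

lemma slope_deriv_nonneg:
  assumes "0 < s" shows "0 \<le> \<kappa>' s"
  by (rule mono_on_imp_deriv_nonneg[OF _ slope_has_derivative[OF assms], of "{0<..}"])
    (use assms in \<open>auto intro!: mono_onI slope_mono simp: interior_open\<close>)

lemma intercept_antimono:
  assumes "0 < s" "s \<le> r" shows "\<tau> r \<le> \<tau> s"
proof (rule DERIV_nonpos_imp_nonincreasing[OF assms(2)])
  fix x assume "s \<le> x"
  then show "\<exists>y. (\<tau> has_real_derivative y) (at x) \<and> y \<le> 0"
    using assms intercept_has_derivative[of x] slope_deriv_nonneg[of x] by auto
qed



text \<open>
  The slope is nonnegative and increasing. Once it vanishes at r, it vanishes identically to the left
  of r, together with its derivative.
\<close>

lemma density_factor_below_zero_slope: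
  assumes "\<kappa> r = 0" "0 < s" "s < r"
  shows "density_factor H s b = 0"
proof -
  have zero: "\<kappa> x = 0" if "0 < x" "x < r" for x
    using slope_mono[of x r] slope_nonneg[of x] that assms by auto
  have "\<forall>\<^sub>F x in nhds s. \<kappa> x = 0"
    using eventually_nhds_in_open[of "{0<..<r}" s] assms zero by (auto elim!: eventually_mono)
  then have "\<kappa>' s = deriv (\<lambda>_. 0) s"
    by (intro deriv_cong_ev) auto
  then show ?thesis using zero[of s] assms by (simp add: density_factor_def)
qed

lemma density_factor_above_zero_intercept:
  assumes "\<tau> r = 0" "0 < r" "r < s"
  shows "density_factor H s b = 0"
proof -
  have zero: "\<tau> x = 0" if "r < x" for x
    using intercept_antimono[of r x] intercept_nonneg[of x] that assms by auto
  have "\<forall>\<^sub>F x in nhds s. \<tau> x = 0"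
    using eventually_nhds_in_open[of "{r<..}" s] assms zero by (auto elim!: eventually_mono)
  then have "deriv \<tau> s = deriv (\<lambda>_. 0) s"
    by (intro deriv_cong_ev) auto
  moreover have "deriv \<tau> s = - s * \<kappa>' s"
    using assms by (intro DERIV_imp_deriv intercept_has_derivative) auto
  ultimately show ?thesis using zero[of s] assms by (simp add: density_factor_def)
qed

lemma pickands_gt_1:
  assumes "0 < s" "\<And>s. 0 < s \<Longrightarrow> 0 < \<kappa> s"
  shows "1 < \<rho> s"
proof -
  have "\<rho> (s / 2) < \<rho> s"
  proof (rule DERIV_pos_imp_increasing[of "s / 2" s \<rho>])
    fix x assume "s / 2 \<le> x"
    then have "0 < x" using assms by linarith
    then show "\<exists>y. (\<rho> has_real_derivative y) (at x) \<and> 0 < y"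
      using pickands_has_derivative assms by blast
  qed (use assms in simp)
  then show ?thesis using pickands_ge[of "s / 2"] by linarith
qed

lemma pickands_gt_self:
  assumes "0 < s" "\<And>s. 0 < s \<Longrightarrow> 0 < \<tau> s"
  shows "s < \<rho> s"
proof -
  have "\<rho> (2 * s) / (2 * s) < \<rho> s / s"
  proof (rule DERIV_neg_imp_decreasing[of s "2 * s" "\<lambda>s. \<rho> s / s"])
    fix x assume "s \<le> x"
    then have "0 < x" using assms by linarith
    moreover from this have "- \<tau> x / x\<^sup>2 < 0" using assms by (simp add: divide_neg_pos)
    ultimately show "\<exists>y. ((\<lambda>s. \<rho> s / s) has_real_derivative y) (at x) \<and> y < 0"
      using quotient_has_derivative by blast
  qed (use assms in simp)
  moreover have "1 \<le> \<rho> (2 * s) / (2 * s)"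
    using pickands_ge(2)[of "2 * s"] assms by simp
  ultimately show ?thesis using assms by (simp add: less_divide_eq)
qed

end

section \<open>Inverted extreme value copulas in exponential coordinates\<close>

text \<open>
  The quantile transform to standard exponential margins; for a conditional distribution function
  this is minus the logarithm of the conditional survival function.
\<close>

definition exp_scale :: "real \<Rightarrow> real" where
  "exp_scale u = - ln (1 - u)"

lemma exp_scale_pos: "0 < u \<Longrightarrow> u < 1 \<Longrightarrow> 0 < exp_scale u"
  by (simp add: exp_scale_def)

lemma exp_scale_inverse: "exp_scale (1 - exp (- a)) = a"
  by (simp add: exp_scale_def)

lemma one_minus_exp_scale: "u < 1 \<Longrightarrow> 1 - u = exp (- exp_scale u)"
  by (simp add: exp_scale_def)

lemma exp_scale_has_derivative:
  assumes "u < 1"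
  shows "(exp_scale has_real_derivative exp (exp_scale u)) (at u)"
proof -
  have "(exp_scale has_real_derivative 1 / (1 - u)) (at u)"
    unfolding exp_scale_def[abs_def] using assms
    by (auto intro!: derivative_eq_intros simp: field_simps)
  then show ?thesis
    using assms by (simp add: one_minus_exp_scale exp_minus field_simps)
qed

lemma DERIV_copula_shape:
  assumes "(g has_real_derivative D) (at u)"
  shows "((\<lambda>u. u + c - 1 + exp (- g u)) has_real_derivative 1 - D * exp (- g u)) (at u)"
  using assms by (auto intro!: derivative_eq_intros)

lemma DERIV_survival_shape:
  assumes "(f has_real_derivative D) (at a)" "(g has_real_derivative E) (at a)"
  shows "((\<lambda>a. 1 - f a * exp (b - g a)) has_real_derivative (f a * E - D) * exp (b - g a)) (at a)"
  using assms by (auto intro!: derivative_eq_intros simp: algebra_simps)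

context smooth_spectral_measure
begin

abbreviation "C \<equiv> inverted_ev_copula (exponent_measure H)"

lemma inverted_ev_copula_eq:
  assumes "0 < v" "v < 1"
  shows "C u v = u + v - 1 + exp (- (exp_scale v * \<rho> (exp_scale u / exp_scale v)))"
proof -
  have "- 1 / ln (1 - x) = 1 / exp_scale x" for x
    by (simp add: exp_scale_def)
  then show ?thesis
    using exponent_measure_pickands[OF exp_scale_pos[OF assms], of H "exp_scale u"]
    by (simp add: inverted_ev_copula_def)
qed

lemma scaled_pickands_deriv1:
  assumes "0 < a" "0 < b"
  shows "((\<lambda>a. b * \<rho> (a / b)) has_real_derivative \<kappa> (a / b)) (at a)"
proof -
  have "((\<lambda>a. a / b) has_real_derivative 1 / b) (at a)"
    using assms by (auto intro!: derivative_eq_intros)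
  moreover have "(\<rho> has_real_derivative \<kappa> (a / b)) (at (a / b))"
    using assms by (intro pickands_has_derivative) simp
  ultimately have "((\<lambda>a. \<rho> (a / b)) has_real_derivative \<kappa> (a / b) * (1 / b)) (at a)"
    by (intro DERIV_chain2[where f = \<rho> and g = "\<lambda>a. a / b"])
  from DERIV_cmult[OF this, of b] show ?thesis using assms by simp
qed

lemma scaled_pickands_deriv2:
  assumes "0 < a" "0 < b"
  shows "((\<lambda>b. b * \<rho> (a / b)) has_real_derivative \<tau> (a / b)) (at b)"
proof -
  have "((\<lambda>b. a / b) has_real_derivative - a / b\<^sup>2) (at b)"
    using assms by (auto intro!: derivative_eq_intros simp: power2_eq_square)
  moreover have "(\<rho> has_real_derivative \<kappa> (a / b)) (at (a / b))"
    using assms by (intro pickands_has_derivative) simp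
  ultimately have "((\<lambda>b. \<rho> (a / b)) has_real_derivative \<kappa> (a / b) * (- a / b\<^sup>2)) (at b)"
    by (intro DERIV_chain2[where f = \<rho> and g = "\<lambda>b. a / b"])
  from DERIV_mult[OF DERIV_ident this] show ?thesis
    using assms by (simp add: pickands_intercept_def power2_eq_square algebra_simps)
qed

lemma partial1_copula:
  assumes "0 < u" "u < 1" "0 < v" "v < 1"
  defines "a \<equiv> exp_scale u" and "b \<equiv> exp_scale v"
  shows "partial1 C u v = 1 - \<kappa> (a / b) * exp (a - b * \<rho> (a / b))"
proof -
  have pos: "0 < a" "0 < b"
    using assms by (auto intro: exp_scale_pos)
  have "((\<lambda>u. b * \<rho> (exp_scale u / b)) has_real_derivative \<kappa> (a / b) * exp a) (at u)"
    using DERIV_chain2[OF scaled_pickands_deriv1[OF pos, unfolded a_def] exp_scale_has_derivative] assms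
    by simp
  from DERIV_copula_shape[OF this, of v]
  have "((\<lambda>u. u + v - 1 + exp (- (b * \<rho> (exp_scale u / b))))
      has_real_derivative 1 - \<kappa> (a / b) * exp (a - b * \<rho> (a / b))) (at u)"
    by (simp add: a_def exp_diff exp_minus divide_inverse mult_ac)
  then show ?thesis
    unfolding partial1_def using assms by (simp add: inverted_ev_copula_eq DERIV_imp_deriv)
qed

lemma partial2_copula:
  assumes "0 < u" "u < 1" "0 < v" "v < 1"
  defines "a \<equiv> exp_scale u" and "b \<equiv> exp_scale v"
  shows "partial2 C u v = 1 - \<tau> (a / b) * exp (b - b * \<rho> (a / b))"
proof -
  have pos: "0 < a" "0 < b"
    using assms by (auto intro: exp_scale_pos)
  have "((\<lambda>v. exp_scale v * \<rho> (a / exp_scale v)) has_real_derivative \<tau> (a / b) * exp b) (at v)"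
    using DERIV_chain2[OF scaled_pickands_deriv2[OF pos, unfolded b_def] exp_scale_has_derivative] assms
    by simp
  from DERIV_copula_shape[OF this, of u]
  have deriv: "((\<lambda>v. u + v - 1 + exp (- (exp_scale v * \<rho> (a / exp_scale v))))
      has_real_derivative 1 - \<tau> (a / b) * exp (b - b * \<rho> (a / b))) (at v)"
    by (simp add: b_def exp_diff exp_minus divide_inverse mult_ac add.commute)
  have "\<forall>\<^sub>F v in nhds v. C u v = u + v - 1 + exp (- (exp_scale v * \<rho> (a / exp_scale v)))"
    using eventually_nhds_in_open[of "{0<..<1}" v] assms
    by (auto elim!: eventually_mono simp: inverted_ev_copula_eq)
  then show ?thesis
    unfolding partial2_def using DERIV_imp_deriv[OF deriv] deriv_cong_ev by metis
qed

lemma partial2_copula_has_derivative: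
  assumes "0 < u" "u < 1" "0 < v" "v < 1"
  defines "a \<equiv> exp_scale u" and "b \<equiv> exp_scale v"
  shows "((\<lambda>u. partial2 C u v) has_real_derivative
            density_factor H (a / b) b * exp (a + b - b * \<rho> (a / b))) (at u)"
proof -
  have pos: "0 < a" "0 < b"
    using assms by (auto intro: exp_scale_pos)
  have "((\<lambda>a. a / b) has_real_derivative 1 / b) (at a)"
    using pos by (auto intro!: derivative_eq_intros)
  moreover have "(\<tau> has_real_derivative - (a / b) * \<kappa>' (a / b)) (at (a / b))"
    using pos by (intro intercept_has_derivative) simp
  ultimately have "((\<lambda>a. \<tau> (a / b)) has_real_derivative - (a / b) * \<kappa>' (a / b) * (1 / b)) (at a)"
    by (intro DERIV_chain2[where f = \<tau> and g = "\<lambda>a. a / b"])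
  from DERIV_survival_shape[OF this scaled_pickands_deriv1[OF pos], of b]
  have "((\<lambda>a. 1 - \<tau> (a / b) * exp (b - b * \<rho> (a / b))) has_real_derivative
      density_factor H (a / b) b * exp (b - b * \<rho> (a / b))) (at a)"
    by (simp add: density_factor_def mult.commute)
  from DERIV_chain2[OF this[unfolded a_def] exp_scale_has_derivative]
  have "((\<lambda>u. 1 - \<tau> (exp_scale u / b) * exp (b - b * \<rho> (exp_scale u / b))) has_real_derivative
      density_factor H (a / b) b * exp (b - b * \<rho> (a / b)) * exp a) (at u)"
    using assms by simp
  moreover have "\<forall>\<^sub>F u in nhds u. partial2 C u v = 1 - \<tau> (exp_scale u / b) * exp (b - b * \<rho> (exp_scale u / b))"
    using eventually_nhds_in_open[of "{0<..<1}" u] assms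
    by (auto elim!: eventually_mono simp: partial2_copula)
  ultimately have "((\<lambda>u. partial2 C u v) has_real_derivative
      density_factor H (a / b) b * exp (b - b * \<rho> (a / b)) * exp a) (at u)"
    by (subst DERIV_cong_ev[OF refl _ refl])
  moreover have "exp (b - b * \<rho> (a / b)) * exp a = exp (a + b - b * \<rho> (a / b))"
    by (simp add: mult_exp_exp)
  ultimately show ?thesis by (simp add: mult.assoc)
qed

lemma copula_density_eq:
  assumes "0 < u" "u < 1" "0 < v" "v < 1"
  defines "a \<equiv> exp_scale u" and "b \<equiv> exp_scale v"
  shows "copula_density C u v = density_factor H (a / b) b * exp (a + b - b * \<rho> (a / b))"
  using DERIV_imp_deriv[OF partial2_copula_has_derivative[OF assms(1-4)]]
  by (simp add: copula_density_def partial1_def a_def b_def)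

lemma density_factor_nonneg:
  assumes "0 < s" "0 < b"
  shows "0 \<le> density_factor H s b"
  using assms slope_nonneg[of s] intercept_nonneg[of s] slope_deriv_nonneg[of s]
  by (simp add: density_factor_def)

lemma density_factor_ge:
  assumes "0 < s" "0 < b"
  shows "\<kappa> s * \<tau> s \<le> density_factor H s b"
  using assms slope_deriv_nonneg[of s] by (simp add: density_factor_def)

lemma continuous_at_slope: "0 < s \<Longrightarrow> isCont \<kappa> s"
  using slope_has_derivative DERIV_isCont by blast

lemma continuous_at_intercept: "0 < s \<Longrightarrow> isCont \<tau> s"
  using intercept_has_derivative DERIV_isCont by blast

lemma continuous_at_pickands: "0 < s \<Longrightarrow> isCont \<rho> s"
  using pickands_has_derivative DERIV_isCont by blast

end

context smooth_spectral_measure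
begin

lemma copula_density_exp:
  assumes "0 < a" "0 < b"
  shows "copula_density C (1 - exp (- a)) (1 - exp (- b)) = density_factor H (a / b) b * exp (a + b - b * \<rho> (a / b))"
  using assms by (subst copula_density_eq) (auto simp: exp_scale_inverse)

text \<open>
  A continuous positive density is a substitute for the existence of a gauge function: positivity
  excludes zeros of slope and intercept, and solving the density for the second derivative of the
  Pickands function shows that this derivative is continuous.
\<close>

context
  assumes density_cont: "continuous_on ({0<..<1} \<times> {0<..<1}) (\<lambda>(u, v). copula_density C u v)"
    and density_pos: "\<forall>u\<in>{0<..<1}. \<forall>v\<in>{0<..<1}. copula_density C u v > 0"
begin

lemma density_factor_pos:
  assumes "0 < s" shows "0 < density_factor H s 1"
proof -
  have "0 < copula_density C (1 - exp (- s)) (1 - exp (- 1))"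
    using density_pos assms by simp
  then show ?thesis
    using copula_density_exp[OF assms, of 1] by (simp add: zero_less_mult_iff)
qed

lemma slope_pos_of_density_pos:
  assumes "0 < s" shows "0 < \<kappa> s"
  using density_factor_below_zero_slope[of s "s / 2" 1] density_factor_pos[of "s / 2"]
    slope_nonneg[OF assms] assms by fastforce

lemma intercept_pos_of_density_pos:
  assumes "0 < s" shows "0 < \<tau> s"
  using density_factor_above_zero_intercept[of s "2 * s" 1] density_factor_pos[of "2 * s"]
    intercept_nonneg[OF assms] assms by fastforce

lemma isCont_slope_deriv:
  assumes "0 < s" shows "isCont \<kappa>' s"
proof -
  define c where "c r = copula_density C (1 - exp (- r)) (1 - exp (- 1))" for r :: real
  have "continuous_on {0<..} (\<lambda>r :: real. (1 - exp (- r), 1 - exp (- 1 :: real)))"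
    by (intro continuous_intros)
  then have "continuous_on {0<..} c"
    unfolding c_def using continuous_on_compose2[OF density_cont] by force
  then have c: "isCont c s"
    using assms by (simp add: continuous_on_eq_continuous_at)
  have "isCont (\<lambda>r. (c r * exp (\<rho> r - r - 1) - \<kappa> r * \<tau> r) / r) s"
    using assms by (intro continuous_intros c continuous_at_pickands continuous_at_slope
        continuous_at_intercept) auto
  moreover have ev: "\<forall>\<^sub>F r in nhds s. (c r * exp (\<rho> r - r - 1) - \<kappa> r * \<tau> r) / r = \<kappa>' r"
  proof (rule eventually_mono)
    show "\<forall>\<^sub>F r in nhds s. r \<in> {0<..}"
      using assms by (intro eventually_nhds_in_open) auto
    fix r :: real assume r: "r \<in> {0<..}"
    have "c r * exp (\<rho> r - r - 1) = density_factor H r 1 * (exp (r + 1 - \<rho> r) * exp (\<rho> r - r - 1))"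
      unfolding c_def using copula_density_exp[of r 1] r by simp
    also have "exp (r + 1 - \<rho> r) * exp (\<rho> r - r - 1) = 1"
      by (simp add: mult_exp_exp)
    finally show "(c r * exp (\<rho> r - r - 1) - \<kappa> r * \<tau> r) / r = \<kappa>' r"
      using r by (simp add: density_factor_def)
  qed
  ultimately show ?thesis
    using isCont_cong[OF ev] by blast
qed

end

end

section \<open>A Borel--Cantelli argument for derivatives\<close>

text \<open>
  The integral of the sum of all w n * f n is finite, hence so is the sum at almost every point, and
  its terms tend to 0 there. The derivatives need not be continuous, so integrability comes from the
  gauge integral and the fundamental theorem of calculus.
\<close>

lemma derivatives_tend_to_zero_somewhere:
  fixes F f :: "nat \<Rightarrow> real \<Rightarrow> real" and w :: "nat \<Rightarrow> real"
  assumes "p < q"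
    and deriv: "\<And>n s. s \<in> {p..q} \<Longrightarrow> (F n has_real_derivative f n s) (at s)"
    and nonneg: "\<And>n s. s \<in> {p..q} \<Longrightarrow> 0 \<le> f n s" "\<And>n. 0 \<le> w n"
    and summable: "summable (\<lambda>n. w n * (F n q - F n p))"
  shows "\<exists>s\<in>{p..q}. (\<lambda>n. w n * f n s) \<longlonglongrightarrow> 0"
proof -
  define h where "h n s = (if s \<in> {p..q} then w n * f n s else 0)" for n s
  have h_nonneg: "0 \<le> h n s" for n s
    using nonneg by (simp add: h_def)
  have "(f n has_integral F n q - F n p) {p..q}" for n
    using assms(1) deriv
    by (intro fundamental_theorem_of_calculus)
       (auto simp: has_real_derivative_iff_has_vector_derivative[symmetric]
             intro: has_field_derivative_at_within)
  then have "(h n has_integral w n * (F n q - F n p)) UNIV" for n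
    unfolding h_def[abs_def] has_integral_restrict_UNIV by (rule has_integral_mult_right)
  then have h: "h n \<in> borel_measurable lebesgue" "integral\<^sup>N lebesgue (h n) = w n * (F n q - F n p)"
      "0 \<le> w n * (F n q - F n p)" for n
    using h_nonneg by (auto simp: has_integral_iff_nn_integral_lebesgue)
  have "(\<integral>\<^sup>+s. (\<Sum>n. ennreal (h n s)) \<partial>lebesgue) = (\<Sum>n. ennreal (w n * (F n q - F n p)))"
    using h by (subst nn_integral_suminf) auto
  also have "\<dots> \<noteq> \<infinity>"
    using summable h(3) by (simp add: suminf_ennreal2)
  finally have "AE s in lebesgue. (\<Sum>n. ennreal (h n s)) \<noteq> \<infinity>"
    using h(1) by (intro nn_integral_PInf_AE) auto
  moreover have "\<not> (AE s in lebesgue. s \<notin> {p..q})"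
  proof
    assume "AE s in lebesgue. s \<notin> {p..q}"
    then have "emeasure lebesgue {p..q} = 0"
      by (subst (asm) AE_iff_measurable[of "{p..q}"]) auto
    then show False using assms(1) by simp
  qed
  ultimately obtain s where s: "s \<in> {p..q}" "(\<Sum>n. ennreal (h n s)) \<noteq> \<infinity>"
    by (metis (mono_tags, lifting) eventually_mono)
  then have "summable (\<lambda>n. h n s)"
    using h_nonneg by (intro summable_suminf_not_top) auto
  then have "(\<lambda>n. h n s) \<longlonglongrightarrow> 0"
    by (rule summable_LIMSEQ_zero)
  then show ?thesis using s(1) by (auto simp: h_def intro!: bexI[of _ s])
qed

section \<open>Densities and conditional distribution functions of a D-vine\<close>

abbreviation (input) scaled :: "real \<Rightarrow> (nat \<Rightarrow> real) \<Rightarrow> nat \<Rightarrow> real" where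
  "scaled t x \<equiv> \<lambda>k. t * x k"

definition edge_density :: "(nat \<Rightarrow> nat \<Rightarrow> real measure) \<Rightarrow> nat \<Rightarrow> nat \<Rightarrow> (nat \<Rightarrow> real) \<Rightarrow> real" where
  "edge_density H i j x =
     copula_density (pair_copula H i j) (cond_cdf_left H x i j) (cond_cdf_right H x i j)"

text \<open>
  The conditional density of coordinate i given the coordinates i+1, ..., j-1. It is the quotient of two
  vine densities and also the derivative of the conditional distribution function; the proof of
  the lower bound for the gauge function uses both descriptions.
\<close>

definition cond_density :: "(nat \<Rightarrow> nat \<Rightarrow> real measure) \<Rightarrow> nat \<Rightarrow> nat \<Rightarrow> (nat \<Rightarrow> real) \<Rightarrow> real" where
  "cond_density H i j x = exp (- x i) * (\<Prod>k\<in>{i<..<j}. edge_density H i k x)"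

lemma cond_cdf_base:
  "cond_cdf_left H x i (Suc i) = 1 - exp (- x i)"
  "cond_cdf_right H x i (Suc i) = 1 - exp (- x (Suc i))"
  by (simp_all add: cond_cdf_left.simps[of H x i] cond_cdf_right.simps[of H x i])

lemma cond_cdf_left_Suc:
  "i < j \<Longrightarrow> cond_cdf_left H x i (Suc j) =
     partial2 (pair_copula H i j) (cond_cdf_left H x i j) (cond_cdf_right H x i j)"
  by (simp add: cond_cdf_left.simps[of H x i "Suc j"])

lemma cond_cdf_right_Suc:
  "Suc i < j \<Longrightarrow> cond_cdf_right H x i j =
     partial1 (pair_copula H (Suc i) j) (cond_cdf_left H x (Suc i) j) (cond_cdf_right H x (Suc i) j)"
  by (simp add: cond_cdf_right.simps[of H x i j])

lemma cond_cdf_cong: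
  assumes "i < j"
  shows "(\<And>k. k \<in> {i..<j} \<Longrightarrow> x k = y k) \<Longrightarrow> cond_cdf_left H x i j = cond_cdf_left H y i j"
    and "(\<And>k. k \<in> {i<..j} \<Longrightarrow> x k = y k) \<Longrightarrow> cond_cdf_right H x i j = cond_cdf_right H y i j"
proof -
  have "((\<forall>k\<in>{i..<j}. x k = y k) \<longrightarrow> cond_cdf_left H x i j = cond_cdf_left H y i j) \<and>
        ((\<forall>k\<in>{i<..j}. x k = y k) \<longrightarrow> cond_cdf_right H x i j = cond_cdf_right H y i j)"
    using assms
  proof (induction "j - i" arbitrary: i j rule: less_induct)
    case less
    show ?case
    proof (cases "j = Suc i")
      case True
      then show ?thesis by (simp add: cond_cdf_base)
    next
      case False
      with less.prems obtain j' where j: "j = Suc j'" "i < j'"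
        by (cases j) auto
      then have "Suc i < j" by simp
      with less.hyps[of j' i] less.hyps[of j "Suc i"] j show ?thesis
        by (auto simp: cond_cdf_left_Suc cond_cdf_right_Suc)
    qed
  qed
  then show "(\<And>k. k \<in> {i..<j} \<Longrightarrow> x k = y k) \<Longrightarrow> cond_cdf_left H x i j = cond_cdf_left H y i j"
    and "(\<And>k. k \<in> {i<..j} \<Longrightarrow> x k = y k) \<Longrightarrow> cond_cdf_right H x i j = cond_cdf_right H y i j"
    by blast+
qed

lemma edge_density_cong:
  assumes "i < j" "\<And>k. k \<in> {i..j} \<Longrightarrow> x k = y k"
  shows "edge_density H i j x = edge_density H i j y"
  using cond_cdf_cong[OF assms(1), of x y H] assms(2) by (simp add: edge_density_def)

lemma dvine_density_empty: "dvine_density H {} x = 1"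
  by (simp add: dvine_density_def)

lemma dvine_density_split:
  assumes "i \<le> j"
  shows "dvine_density H {i..j} x = cond_density H i (Suc j) x * dvine_density H {Suc i..j} x"
proof -
  let ?c = "\<lambda>(p, q). edge_density H p q x"
  let ?P = "\<lambda>m. {(p, q). p \<in> {m..j} \<and> q \<in> {m..j} \<and> p < q}"
  have fin: "finite (?P (Suc i))"
    by (rule finite_subset[of _ "{Suc i..j} \<times> {Suc i..j}"]) auto
  have pairs: "?P i = Pair i ` {i<..<Suc j} \<union> ?P (Suc i)"
    using assms by (auto simp: image_iff)
  have "(\<Prod>pq\<in>?P i. ?c pq) = (\<Prod>pq\<in>Pair i ` {i<..<Suc j}. ?c pq) * (\<Prod>pq\<in>?P (Suc i). ?c pq)"
    unfolding pairs by (rule prod.union_disjoint) (use fin in auto)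
  also have "(\<Prod>pq\<in>Pair i ` {i<..<Suc j}. ?c pq) = (\<Prod>k\<in>{i<..<Suc j}. edge_density H i k x)"
    by (subst prod.reindex) (auto simp: inj_on_def)
  finally have c: "(\<Prod>pq\<in>?P i. ?c pq) =
      (\<Prod>k\<in>{i<..<Suc j}. edge_density H i k x) * (\<Prod>pq\<in>?P (Suc i). ?c pq)" .
  have "{i..j} = insert i {Suc i..j}"
    using assms by auto
  then have "(\<Prod>k\<in>{i..j}. exp (- x k)) = exp (- x i) * (\<Prod>k\<in>{Suc i..j}. exp (- x k))"
    by simp
  with c show ?thesis
    by (simp add: dvine_density_def cond_density_def edge_density_def[symmetric] case_prod_unfold mult_ac)
qed

lemma cond_density_Suc:
  assumes "i < j"
  shows "cond_density H i (Suc j) x = cond_density H i j x * edge_density H i j x"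
proof -
  have "{i<..<Suc j} = insert j {i<..<j}"
    using assms by auto
  then show ?thesis by (simp add: cond_density_def mult_ac)
qed

lemma cond_density_base: "cond_density H i (Suc i) x = exp (- x i)"
proof -
  have "{i<..<Suc i} = {}" by auto
  then show ?thesis by (simp add: cond_density_def)
qed

lemma dvine_density_cong:
  assumes "\<And>k. k \<in> {m..n} \<Longrightarrow> x k = y k"
  shows "dvine_density H {m..n} x = dvine_density H {m..n} y"
proof -
  have "edge_density H i j x = edge_density H i j y" if "m \<le> i" "i < j" "j \<le> n" for i j
    using that assms by (intro edge_density_cong) auto
  then show ?thesis
    using assms unfolding dvine_density_def edge_density_def[symmetric]
    by (intro arg_cong2[where f = "(*)"] prod.cong) auto
qed

section \<open>Gauge functions of blocks\<close>

lemma asymp_equiv_linear_iff: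
  fixes f :: "real \<Rightarrow> real"
  assumes "c \<noteq> 0"
  shows "f \<sim>[at_top] (\<lambda>t. t * c) \<longleftrightarrow> ((\<lambda>t. f t / t) \<longlongrightarrow> c) at_top"
proof -
  have "f \<sim>[at_top] (\<lambda>t. t * c) \<longleftrightarrow> ((\<lambda>t. f t / (t * c)) \<longlongrightarrow> 1) at_top"
  proof
    assume "f \<sim>[at_top] (\<lambda>t. t * c)"
    then show "((\<lambda>t. f t / (t * c)) \<longlongrightarrow> 1) at_top"
      by (rule asymp_equivD_strong) (use assms in \<open>auto intro: eventually_mono[OF eventually_gt_at_top[of 0]]\<close>)
  qed (rule asymp_equivI')
  also have "\<dots> \<longleftrightarrow> ((\<lambda>t. f t / t) \<longlongrightarrow> c) at_top"
  proof
    assume "((\<lambda>t. f t / (t * c)) \<longlongrightarrow> 1) at_top"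
    from tendsto_mult_right[OF this, of c] show "((\<lambda>t. f t / t) \<longlongrightarrow> c) at_top"
      using assms by simp
  next
    assume "((\<lambda>t. f t / t) \<longlongrightarrow> c) at_top"
    from tendsto_divide[OF this tendsto_const, of c] show "((\<lambda>t. f t / (t * c)) \<longlongrightarrow> 1) at_top"
      using assms by (simp add: field_simps)
  qed
  finally show ?thesis .
qed

text \<open>
  Asymptotic equivalence to 0 means being eventually 0, so this direction holds for c = 0 as well.
\<close>

lemma asymp_equiv_linearD:
  fixes f :: "real \<Rightarrow> real"
  assumes "f \<sim>[at_top] (\<lambda>t. t * c)"
  shows "((\<lambda>t. f t / t) \<longlongrightarrow> c) at_top"
proof (cases "c = 0")
  case True
  then have "\<forall>\<^sub>F t in at_top. f t = 0"
    using asymp_equiv_eventually_zeros[OF assms] by simp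
  then have "\<forall>\<^sub>F t in at_top. f t / t = c"
    by eventually_elim (simp add: True)
  then show ?thesis by (rule tendsto_eventually)
qed (use assms asymp_equiv_linear_iff in blast)

definition positive :: "(nat \<Rightarrow> real) \<Rightarrow> bool" where
  "positive x \<longleftrightarrow> (\<forall>k. 0 < x k)"

lemma positive_update: "positive x \<Longrightarrow> 0 < s \<Longrightarrow> positive (x(i := s))"
  by (simp add: positive_def)

lemma positive_scaled: "positive x \<Longrightarrow> 0 < t \<Longrightarrow> positive (scaled t x)"
  by (simp add: positive_def)

text \<open>
  Gauge functions are given for all blocks of at most k consecutive coordinates. The full vine is reached
  with k = d - 1 or, if it is known to have a gauge function itself, with k = d.
\<close>

locale dvine_gauges =
  fixes d :: nat and H :: "nat \<Rightarrow> nat \<Rightarrow> real measure"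
    and g :: "nat set \<Rightarrow> (nat \<Rightarrow> real) \<Rightarrow> real" and k :: nat
  assumes smooth: "1 \<le> i \<Longrightarrow> i < j \<Longrightarrow> j \<le> d \<Longrightarrow> smooth_spectral_measure (H i j)"
    and gauges: "1 \<le> m \<Longrightarrow> m \<le> n \<Longrightarrow> n \<le> d \<Longrightarrow> n - m < k \<Longrightarrow>
          gauge_function {m..n} (dvine_density H {m..n}) (g {m..n})"
begin

text \<open>
  On an empty block the vine density is 1, whose gauge function is 0; with this value the recursion starts
  at pairs of adjacent coordinates, whose conditioning set is empty.
\<close>

definition block_gauge :: "nat \<Rightarrow> nat \<Rightarrow> (nat \<Rightarrow> real) \<Rightarrow> real" where
  "block_gauge m n x = (if m \<le> n then g {m..n} (restrict x {m..n}) else 0)"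

text \<open>
  The linear growth rates along the ray through x of the exponential coordinates at the edge {i, j}.
\<close>

definition left_rate :: "nat \<Rightarrow> nat \<Rightarrow> (nat \<Rightarrow> real) \<Rightarrow> real" where
  "left_rate i j x = block_gauge i (j - 1) x - block_gauge (Suc i) (j - 1) x"

definition right_rate :: "nat \<Rightarrow> nat \<Rightarrow> (nat \<Rightarrow> real) \<Rightarrow> real" where
  "right_rate i j x = block_gauge (Suc i) j x - block_gauge (Suc i) (j - 1) x"

lemma block_gauge_cong:
  "(\<And>k. k \<in> {m..n} \<Longrightarrow> x k = y k) \<Longrightarrow> block_gauge m n x = block_gauge m n y"
  unfolding block_gauge_def by (simp cong: restrict_cong)

lemma left_rate_update: "left_rate i j (x(j := s)) = left_rate i j x" if "i < j"
  using that unfolding left_rate_def by (auto intro!: arg_cong2[where f = "(-)"] block_gauge_cong)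

lemma right_rate_update: "right_rate i j (x(i := s)) = right_rate i j x" if "i < j"
  using that unfolding right_rate_def by (auto intro!: arg_cong2[where f = "(-)"] block_gauge_cong)

text \<open>
  Vectors that are positive in all coordinates replace those that are undefined outside the block,
  since a block density depends on the coordinates of the block only.
\<close>

lemma block_gauge_limit:
  assumes "positive x" "1 \<le> m" "n \<le> d" "n < m + k"
  shows "\<forall>\<^sub>F t in at_top. 0 < dvine_density H {m..n} (scaled t x)"
    and "((\<lambda>t. - ln (dvine_density H {m..n} (scaled t x)) / t) \<longlongrightarrow> block_gauge m n x) at_top"
proof -
  have "(\<forall>\<^sub>F t in at_top. 0 < dvine_density H {m..n} (scaled t x)) \<and>
    ((\<lambda>t. - ln (dvine_density H {m..n} (scaled t x)) / t) \<longlongrightarrow> block_gauge m n x) at_top"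
  proof (cases "m \<le> n")
    case False
    then show ?thesis by (simp add: dvine_density_empty block_gauge_def)
  next
    case True
    let ?x = "restrict x {m..n}"
    have "gauge_function {m..n} (dvine_density H {m..n}) (g {m..n})"
      using assms True by (intro gauges) auto
    moreover have "?x \<in> {m..n} \<rightarrow>\<^sub>E {0<..}"
      using assms(1) by (auto simp: positive_def)
    ultimately have "(\<forall>\<^sub>F t in at_top. 0 < dvine_density H {m..n} (\<lambda>k\<in>{m..n}. t * ?x k)) \<and>
        (\<lambda>t. - ln (dvine_density H {m..n} (\<lambda>k\<in>{m..n}. t * ?x k))) \<sim>[at_top] (\<lambda>t. t * g {m..n} ?x)"
      unfolding gauge_function_def by blast
    moreover have "dvine_density H {m..n} (\<lambda>k\<in>{m..n}. t * ?x k) = dvine_density H {m..n} (scaled t x)" for t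
      by (rule dvine_density_cong) simp
    ultimately show ?thesis
      using True asymp_equiv_linearD by (simp only: block_gauge_def if_True)
  qed
  then show "\<forall>\<^sub>F t in at_top. 0 < dvine_density H {m..n} (scaled t x)"
    "((\<lambda>t. - ln (dvine_density H {m..n} (scaled t x)) / t) \<longlongrightarrow> block_gauge m n x) at_top"
    by blast+
qed

lemma continuous_block_gauge:
  assumes "positive x" "1 \<le> m" "n \<le> d" "n < m + k"
  shows "continuous_on {0<..} (\<lambda>s. block_gauge m n (x(i := s)))"
proof (cases "m \<le> n")
  case False
  then show ?thesis by (simp add: block_gauge_def)
next
  case True
  then have "gauge_function {m..n} (dvine_density H {m..n}) (g {m..n})"
    using assms by (intro gauges) auto
  then have "continuous_on ({m..n} \<rightarrow>\<^sub>E {0..}) (g {m..n})"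
    by (simp add: gauge_function_def)
  moreover have "continuous_on {0<..} (\<lambda>s. restrict (x(i := s)) {m..n})"
  proof (rule continuous_on_coordinatewise_then_product)
    fix k
    consider "k \<notin> {m..n}" | "k \<in> {m..n}" "k = i" | "k \<in> {m..n}" "k \<noteq> i" by blast
    then show "continuous_on {0<..} (\<lambda>s. restrict (x(i := s)) {m..n} k)"
      by cases auto
  qed
  moreover have "(\<lambda>s. restrict (x(i := s)) {m..n}) ` {0<..} \<subseteq> {m..n} \<rightarrow>\<^sub>E {0..}"
    using assms(1) by (auto simp: positive_def intro: less_imp_le)
  ultimately show ?thesis
    using True continuous_on_compose2[of _ "g {m..n}"] by (simp add: block_gauge_def)
qed

lemma block_gauge_single:
  assumes "positive x" "1 \<le> i" "i \<le> d" "0 < k"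
  shows "block_gauge i i x = x i"
proof -
  have dens: "dvine_density H {i..i} y = exp (- y i)" for y
    by (simp add: dvine_density_split cond_density_base dvine_density_empty del: atLeastAtMost_singleton)
  have "((\<lambda>t. - ln (dvine_density H {i..i} (scaled t x)) / t) \<longlongrightarrow> block_gauge i i x) at_top"
    using assms by (intro block_gauge_limit) auto
  moreover have "((\<lambda>t. - ln (dvine_density H {i..i} (scaled t x)) / t) \<longlongrightarrow> x i) at_top"
  proof (rule tendsto_eventually)
    show "\<forall>\<^sub>F t in at_top. - ln (dvine_density H {i..i} (scaled t x)) / t = x i"
      using eventually_gt_at_top[of 0] by eventually_elim (simp only: dens, simp)
  qed
  ultimately show ?thesis
    by (rule tendsto_unique[OF trivial_limit_at_top_linorder])
qed

text \<open>
  The induction hypothesis for the first coordinate at the edge {i, j}. As the rate is unbounded in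
  the outer coordinate, the limiting direction at the edge can be pushed arbitrarily close to an axis;
  the derivative and its sign feed the Borel--Cantelli argument.
\<close>

definition left_ok :: "nat \<Rightarrow> nat \<Rightarrow> bool" where
  "left_ok i j \<longleftrightarrow> (\<forall>x. positive x \<longrightarrow>
     0 < cond_cdf_left H x i j \<and> cond_cdf_left H x i j < 1 \<and>
     ((\<lambda>s. cond_cdf_left H (x(i := s)) i j) has_real_derivative cond_density H i j x) (at (x i)) \<and>
     0 \<le> cond_density H i j x \<and>
     ((\<lambda>t. exp_scale (cond_cdf_left H (scaled t x) i j) / t) \<longlongrightarrow> left_rate i j x) at_top \<and>
     0 < left_rate i j x \<and> (\<forall>M. \<exists>s>0. M \<le> left_rate i j (x(i := s))))"

definition right_ok :: "nat \<Rightarrow> nat \<Rightarrow> bool" where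
  "right_ok i j \<longleftrightarrow> (\<forall>x. positive x \<longrightarrow>
     0 < cond_cdf_right H x i j \<and> cond_cdf_right H x i j < 1 \<and>
     ((\<lambda>t. exp_scale (cond_cdf_right H (scaled t x) i j) / t) \<longlongrightarrow> right_rate i j x) at_top \<and>
     0 < right_rate i j x \<and> (\<forall>M. \<exists>s>0. M \<le> right_rate i j (x(j := s))))"

lemma tendsto_exp_scale_linear:
  "((\<lambda>t. exp_scale (1 - exp (- (t * c))) / t) \<longlongrightarrow> c) at_top"
proof (rule tendsto_eventually)
  show "\<forall>\<^sub>F t in at_top. exp_scale (1 - exp (- (t * c))) / t = c"
    using eventually_gt_at_top[of 0] by eventually_elim (simp add: exp_scale_inverse)
qed

lemma left_ok_base:
  assumes "1 \<le> i" "i \<le> d" "0 < k"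
  shows "left_ok i (Suc i)"
proof -
  have rate: "left_rate i (Suc i) x = x i" if "positive x" for x
    using block_gauge_single[OF that assms] by (simp add: left_rate_def block_gauge_def)
  have "\<exists>s>0. M \<le> left_rate i (Suc i) (x(i := s))" if "positive x" for x M
    using that by (intro exI[of _ "max M 1"]) (simp add: rate positive_update)
  moreover have "((\<lambda>s. 1 - exp (- s)) has_real_derivative exp (- c)) (at c)" for c :: real
    by (auto intro!: derivative_eq_intros)
  ultimately show ?thesis
    by (auto simp: left_ok_def cond_cdf_base cond_density_base rate tendsto_exp_scale_linear)
      (auto simp: positive_def)
qed

lemma right_ok_base:
  assumes "1 \<le> Suc i" "Suc i \<le> d" "0 < k"
  shows "right_ok i (Suc i)"
proof -
  have rate: "right_rate i (Suc i) x = x (Suc i)" if "positive x" for x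
    using block_gauge_single[OF that assms] by (simp add: right_rate_def block_gauge_def)
  have "\<exists>s>0. M \<le> right_rate i (Suc i) (x(Suc i := s))" if "positive x" for x M
    using that by (intro exI[of _ "max M 1"]) (simp add: rate positive_update)
  then show ?thesis
    by (auto simp: right_ok_def cond_cdf_base rate tendsto_exp_scale_linear)
      (auto simp: positive_def)
qed

end

section \<open>The asymptotics at one edge\<close>

locale dvine_edge = dvine_gauges +
  fixes i j :: nat
  assumes edge: "1 \<le> i" "i < j" "j \<le> d" "j < Suc (i + k)"
    and left: "left_ok i j" and right: "right_ok i j"
begin

sublocale smooth_spectral_measure "H i j"
  using edge by (intro smooth) auto

definition a :: "(nat \<Rightarrow> real) \<Rightarrow> real" where
  "a x = exp_scale (cond_cdf_left H x i j)"

definition b :: "(nat \<Rightarrow> real) \<Rightarrow> real" where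
  "b x = exp_scale (cond_cdf_right H x i j)"

abbreviation "\<alpha> \<equiv> left_rate i j"
abbreviation "\<beta> \<equiv> right_rate i j"

context
  fixes x :: "nat \<Rightarrow> real"
  assumes x: "positive x"
begin

lemma cdf_bounds:
  "0 < cond_cdf_left H x i j" "cond_cdf_left H x i j < 1"
  "0 < cond_cdf_right H x i j" "cond_cdf_right H x i j < 1"
  using left right x by (auto simp: left_ok_def right_ok_def)

lemma a_pos: "0 < a x" and b_pos: "0 < b x"
  using cdf_bounds by (auto simp: a_def b_def exp_scale_pos)

lemma ratio_pos: "0 < a x / b x"
  using a_pos b_pos by simp

lemma rates_pos: "0 < \<alpha> x" "0 < \<beta> x" "0 < \<alpha> x / \<beta> x"
  using left right x by (auto simp: left_ok_def right_ok_def)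

lemma a_limit: "((\<lambda>t. a (scaled t x) / t) \<longlongrightarrow> \<alpha> x) at_top"
  and b_limit: "((\<lambda>t. b (scaled t x) / t) \<longlongrightarrow> \<beta> x) at_top"
  using left right x by (auto simp: left_ok_def right_ok_def a_def b_def)

lemma ratio_limit: "((\<lambda>t. a (scaled t x) / b (scaled t x)) \<longlongrightarrow> \<alpha> x / \<beta> x) at_top"
proof -
  have "((\<lambda>t. (a (scaled t x) / t) / (b (scaled t x) / t)) \<longlongrightarrow> \<alpha> x / \<beta> x) at_top"
    using rates_pos by (intro tendsto_divide a_limit b_limit) auto
  moreover have "\<forall>\<^sub>F t in at_top. (a (scaled t x) / t) / (b (scaled t x) / t) = a (scaled t x) / b (scaled t x)"
    using eventually_gt_at_top[of 0] by eventually_elim simp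
  ultimately show ?thesis by (rule Lim_transform_eventually)
qed

lemma scaled_pickands_limit:
  "((\<lambda>t. b (scaled t x) * \<rho> (a (scaled t x) / b (scaled t x)) / t) \<longlongrightarrow> \<beta> x * \<rho> (\<alpha> x / \<beta> x)) at_top"
proof -
  have "((\<lambda>t. b (scaled t x) / t * \<rho> (a (scaled t x) / b (scaled t x))) \<longlongrightarrow> \<beta> x * \<rho> (\<alpha> x / \<beta> x)) at_top"
    using rates_pos by (intro tendsto_mult b_limit isCont_tendsto_compose[OF continuous_at_pickands] ratio_limit)
  then show ?thesis by (simp add: mult_ac)
qed

lemma edge_density_eq:
  "edge_density H i j x = density_factor (H i j) (a x / b x) (b x) * exp (a x + b x - b x * \<rho> (a x / b x))"
  using copula_density_eq[OF cdf_bounds]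
  by (simp add: edge_density_def pair_copula_def a_def b_def)

lemma edge_density_nonneg: "0 \<le> edge_density H i j x"
  using density_factor_nonneg[OF ratio_pos b_pos] by (simp add: edge_density_eq)

lemma rates_update:
  "\<alpha> (x(j := s)) = \<alpha> x" "\<beta> (x(i := s)) = \<beta> x"
  using edge by (simp_all add: left_rate_update right_rate_update)

text \<open>
  The outer coordinate i enters the first rate only, where it is unbounded, and symmetrically for j.
\<close>

lemma left_dominates: "\<exists>y. positive y \<and> r < \<alpha> y / \<beta> y"
proof -
  obtain s where s: "0 < s" "\<beta> x * (\<bar>r\<bar> + 1) \<le> \<alpha> (x(i := s))"
    using left x unfolding left_ok_def by metis
  have "r * \<beta> x < \<beta> x * (\<bar>r\<bar> + 1)"
    using rates_pos by (simp add: algebra_simps) (smt (verit) mult_right_mono)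
  also have "\<dots> \<le> \<alpha> (x(i := s))" by (rule s)
  finally have "r < \<alpha> (x(i := s)) / \<beta> (x(i := s))"
    using rates_pos by (simp add: rates_update less_divide_eq)
  then show ?thesis using positive_update[OF x s(1)] by blast
qed

lemma right_dominates:
  assumes "0 < r" shows "\<exists>y. positive y \<and> \<alpha> y / \<beta> y < r"
proof -
  obtain s where s: "0 < s" "2 * \<alpha> x / r \<le> \<beta> (x(j := s))"
    using right x unfolding right_ok_def by metis
  then have "\<alpha> (x(j := s)) < r * \<beta> (x(j := s))"
    using assms rates_pos by (simp add: rates_update divide_le_eq mult.commute)
  moreover have "0 < \<beta> (x(j := s))"
    using s(2) assms rates_pos by (smt (verit) divide_pos_pos)
  ultimately have "\<alpha> (x(j := s)) / \<beta> (x(j := s)) < r"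
    by (simp add: divide_less_eq)
  then show ?thesis using positive_update[OF x s(1)] by blast
qed

lemma vine_factorisation:
  "dvine_density H {i..j} x * dvine_density H {Suc i..j - 1} x =
     dvine_density H {i..j - 1} x * dvine_density H {Suc i..j} x * edge_density H i j x"
  using edge dvine_density_split[of i j H x] dvine_density_split[of i "j - 1" H x]
    cond_density_Suc[of i j H x] by simp

end

lemma subblock_limit:
  assumes "positive x" "(m, n) \<in> {(i, j - 1), (Suc i, j), (Suc i, j - 1)}"
  shows "\<forall>\<^sub>F t in at_top. 0 < dvine_density H {m..n} (scaled t x)"
    and "((\<lambda>t. - ln (dvine_density H {m..n} (scaled t x)) / t) \<longlongrightarrow> block_gauge m n x) at_top"
proof -
  have "1 \<le> m" "n \<le> d" "n < m + k"
    using assms(2) edge by auto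
  from block_gauge_limit[OF assms(1) this]
  show "\<forall>\<^sub>F t in at_top. 0 < dvine_density H {m..n} (scaled t x)"
    "((\<lambda>t. - ln (dvine_density H {m..n} (scaled t x)) / t) \<longlongrightarrow> block_gauge m n x) at_top"
    by blast+
qed

text \<open>
  The copula density at the edge is left in a premise because its positivity has different reasons
  with and without a gauge function for the block.
\<close>

lemma log_density_split:
  assumes "positive x"
  shows "\<forall>\<^sub>F t in at_top. 0 < edge_density H i j (scaled t x) \<longrightarrow>
     0 < dvine_density H {i..j} (scaled t x) \<and>
     - ln (dvine_density H {i..j} (scaled t x)) / t =
       - ln (dvine_density H {i..j - 1} (scaled t x)) / t
       + - ln (dvine_density H {Suc i..j} (scaled t x)) / t
       - (- ln (dvine_density H {Suc i..j - 1} (scaled t x)) / t)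
       + - ln (edge_density H i j (scaled t x)) / t"
proof -
  have pos: "\<forall>\<^sub>F t in at_top. 0 < dvine_density H {i..j - 1} (scaled t x)"
    "\<forall>\<^sub>F t in at_top. 0 < dvine_density H {Suc i..j} (scaled t x)"
    "\<forall>\<^sub>F t in at_top. 0 < dvine_density H {Suc i..j - 1} (scaled t x)"
    by (rule subblock_limit(1)[OF assms]; blast)+
  show ?thesis
    using pos eventually_gt_at_top[of 0]
  proof eventually_elim
    case (elim t)
    let ?f = "\<lambda>m n. dvine_density H {m..n} (scaled t x)" and ?c = "edge_density H i j (scaled t x)"
    have eq: "?f i j = ?f i (j - 1) * ?f (Suc i) j * ?c / ?f (Suc i) (j - 1)"
      using vine_factorisation[OF positive_scaled[OF assms]] elim by (simp add: eq_divide_eq)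
    show ?case
    proof
      assume c: "0 < ?c"
      have "ln (?f i j) = ln (?f i (j - 1)) + ln (?f (Suc i) j) + ln ?c - ln (?f (Suc i) (j - 1))"
        unfolding eq using elim c by (simp add: ln_mult ln_div)
      moreover have "0 < ?f i j"
        unfolding eq using elim c by simp
      ultimately show "0 < ?f i j \<and> - ln (?f i j) / t =
         - ln (?f i (j - 1)) / t + - ln (?f (Suc i) j) / t - (- ln (?f (Suc i) (j - 1)) / t) + - ln ?c / t"
        by (simp add: diff_divide_distrib add_divide_distrib)
    qed
  qed
qed

text \<open>
  The right-hand side of the recursion for the gauge function of the block i..j, with the exponent
  measure expressed by the Pickands function.
\<close>

definition edge_gauge :: "(nat \<Rightarrow> real) \<Rightarrow> real" where
  "edge_gauge x = block_gauge (Suc i) (j - 1) x + \<beta> x * \<rho> (\<alpha> x / \<beta> x)"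

lemma log_edge_density:
  assumes "positive x" "0 < edge_density H i j x"
  shows "- ln (edge_density H i j x) =
     b x * \<rho> (a x / b x) - a x - b x - ln (density_factor (H i j) (a x / b x) (b x))"
proof -
  have "0 < density_factor (H i j) (a x / b x) (b x)"
    using assms edge_density_eq[OF assms(1)] by (simp add: zero_less_mult_iff)
  then show ?thesis
    by (simp add: edge_density_eq[OF assms(1)] ln_mult)
qed

lemma log_slopes_vanish:
  assumes x: "positive x" and pos: "\<And>s. 0 < s \<Longrightarrow> 0 < \<kappa> s" "\<And>s. 0 < s \<Longrightarrow> 0 < \<tau> s"
  shows "((\<lambda>t. ln (\<kappa> (a (scaled t x) / b (scaled t x))) / t) \<longlongrightarrow> 0) at_top"
    and "((\<lambda>t. ln (\<tau> (a (scaled t x) / b (scaled t x))) / t) \<longlongrightarrow> 0) at_top"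
proof -
  note r = rates_pos(3)[OF x]
  have "((\<lambda>t. ln (\<kappa> (a (scaled t x) / b (scaled t x)))) \<longlongrightarrow> ln (\<kappa> (\<alpha> x / \<beta> x))) at_top"
    using pos(1)[OF r]
    by (intro tendsto_ln isCont_tendsto_compose[OF continuous_at_slope[OF r]] ratio_limit x) auto
  then show "((\<lambda>t. ln (\<kappa> (a (scaled t x) / b (scaled t x))) / t) \<longlongrightarrow> 0) at_top"
    by (rule tendsto_divide_0) (simp add: filterlim_at_top_imp_at_infinity filterlim_ident)
  have "((\<lambda>t. ln (\<tau> (a (scaled t x) / b (scaled t x)))) \<longlongrightarrow> ln (\<tau> (\<alpha> x / \<beta> x))) at_top"
    using pos(2)[OF r]
    by (intro tendsto_ln isCont_tendsto_compose[OF continuous_at_intercept[OF r]] ratio_limit x) auto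
  then show "((\<lambda>t. ln (\<tau> (a (scaled t x) / b (scaled t x))) / t) \<longlongrightarrow> 0) at_top"
    by (rule tendsto_divide_0) (simp add: filterlim_at_top_imp_at_infinity filterlim_ident)
qed

end

text \<open>
  Here the block i..j itself has a gauge function. This is what makes the edge regular enough for
  the induction to pass to the next level.
\<close>

locale dvine_edge_gauge = dvine_edge +
  assumes size: "j < i + k"
begin

lemma eventually_edge_density_pos:
  assumes "positive x"
  shows "\<forall>\<^sub>F t in at_top. 0 < edge_density H i j (scaled t x)"
proof -
  have "\<forall>\<^sub>F t in at_top. 0 < dvine_density H {i..j} (scaled t x)"
    using assms edge size by (intro block_gauge_limit) auto
  with eventually_gt_at_top[of 0] show ?thesis
  proof eventually_elim
    case (elim t)
    have "edge_density H i j (scaled t x) \<noteq> 0"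
      using elim edge dvine_density_split[of i j H "scaled t x"] cond_density_Suc[of i j H "scaled t x"]
      by auto
    then show ?case
      using edge_density_nonneg[OF positive_scaled[OF assms]] elim by fastforce
  qed
qed

text \<open>
  A zero of the slope kills the copula density for all smaller ratios a / b. Increasing the outer
  coordinate j lowers the limit of this ratio below the zero, and the block density would vanish far
  out on a ray.
\<close>

lemma slope_pos:
  assumes "0 < r" shows "0 < \<kappa> r"
proof (rule ccontr)
  assume "\<not> 0 < \<kappa> r"
  then have zero: "\<kappa> r = 0"
    using slope_nonneg[OF assms] by simp
  obtain x where x: "positive x" "\<alpha> x / \<beta> x < r"
    using right_dominates[of "\<lambda>_. 1"] assms by (auto simp: positive_def)
  have "\<forall>\<^sub>F t in at_top. a (scaled t x) / b (scaled t x) < r"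
    using order_tendstoD(2)[OF ratio_limit[OF x(1)] x(2)] .
  with eventually_edge_density_pos[OF x(1)] eventually_gt_at_top[of 0]
  have "\<forall>\<^sub>F t in (at_top :: real filter). False"
  proof eventually_elim
    case (elim t)
    note t = positive_scaled[OF x(1) elim(2)]
    show ?case
      using elim density_factor_below_zero_slope[OF zero ratio_pos[OF t]]
      by (simp add: edge_density_eq[OF t])
  qed
  then show False by simp
qed

lemma intercept_pos:
  assumes "0 < r" shows "0 < \<tau> r"
proof (rule ccontr)
  assume "\<not> 0 < \<tau> r"
  then have zero: "\<tau> r = 0"
    using intercept_nonneg[OF assms] by simp
  obtain x where x: "positive x" "r < \<alpha> x / \<beta> x"
    using left_dominates[of "\<lambda>_. 1"] by (auto simp: positive_def)
  have "\<forall>\<^sub>F t in at_top. r < a (scaled t x) / b (scaled t x)"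
    using order_tendstoD(1)[OF ratio_limit[OF x(1)] x(2)] .
  with eventually_edge_density_pos[OF x(1)] eventually_gt_at_top[of 0]
  have "\<forall>\<^sub>F t in (at_top :: real filter). False"
  proof eventually_elim
    case (elim t)
    show ?case
      using elim density_factor_above_zero_intercept[OF zero assms]
      by (simp add: edge_density_eq[OF positive_scaled[OF x(1) elim(2)]])
  qed
  then show False by simp
qed

lemma log_edge_density_limit:
  assumes x: "positive x"
  shows "((\<lambda>t. - ln (edge_density H i j (scaled t x)) / t) \<longlongrightarrow>
     block_gauge i j x - block_gauge (Suc i) (j - 1) x - \<alpha> x - \<beta> x) at_top"
proof -
  let ?L = "\<lambda>m n t. - ln (dvine_density H {m..n} (scaled t x)) / t"
  have "((\<lambda>t. ?L i j t - ?L i (j - 1) t - ?L (Suc i) j t + ?L (Suc i) (j - 1) t) \<longlongrightarrow>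
      block_gauge i j x - block_gauge i (j - 1) x - block_gauge (Suc i) j x + block_gauge (Suc i) (j - 1) x) at_top"
    using edge size by (intro tendsto_intros block_gauge_limit subblock_limit x) auto
  moreover have "\<forall>\<^sub>F t in at_top. ?L i j t - ?L i (j - 1) t - ?L (Suc i) j t + ?L (Suc i) (j - 1) t
      = - ln (edge_density H i j (scaled t x)) / t"
    using log_density_split[OF x] eventually_edge_density_pos[OF x] by eventually_elim simp
  ultimately have "((\<lambda>t. - ln (edge_density H i j (scaled t x)) / t) \<longlongrightarrow>
    block_gauge i j x - block_gauge i (j - 1) x - block_gauge (Suc i) j x + block_gauge (Suc i) (j - 1) x) at_top"
    by (rule Lim_transform_eventually)
  then show ?thesis by (simp add: left_rate_def right_rate_def algebra_simps)
qed

text \<open>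
  Dropping the nonnegative second derivative from the density factor leaves the product of slope and
  intercept, which converges to a positive limit along the ray.
\<close>

lemma block_gauge_le:
  assumes x: "positive x"
  shows "block_gauge i j x \<le> edge_gauge x"
proof -
  let ?s = "\<lambda>t. a (scaled t x) / b (scaled t x)"
  have "((\<lambda>t. b (scaled t x) * \<rho> (?s t) / t - a (scaled t x) / t - b (scaled t x) / t
        - ln (\<kappa> (?s t)) / t - ln (\<tau> (?s t)) / t) \<longlongrightarrow>
      \<beta> x * \<rho> (\<alpha> x / \<beta> x) - \<alpha> x - \<beta> x - 0 - 0) at_top"
    by (intro tendsto_diff scaled_pickands_limit a_limit b_limit log_slopes_vanish x slope_pos intercept_pos)
  moreover have "\<forall>\<^sub>F t in at_top. - ln (edge_density H i j (scaled t x)) / t \<le>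
      b (scaled t x) * \<rho> (?s t) / t - a (scaled t x) / t - b (scaled t x) / t
        - ln (\<kappa> (?s t)) / t - ln (\<tau> (?s t)) / t"
    using eventually_edge_density_pos[OF x] eventually_gt_at_top[of 0]
  proof eventually_elim
    case (elim t)
    note t = positive_scaled[OF x elim(2)]
    have pos: "0 < \<kappa> (?s t)" "0 < \<tau> (?s t)"
      using slope_pos intercept_pos ratio_pos[OF t] by auto
    have "ln (\<kappa> (?s t) * \<tau> (?s t)) \<le> ln (density_factor (H i j) (?s t) (b (scaled t x)))"
      using pos density_factor_ge[OF ratio_pos[OF t] b_pos[OF t]] by (intro ln_mono) auto
    then have "- ln (edge_density H i j (scaled t x)) \<le>
        b (scaled t x) * \<rho> (?s t) - a (scaled t x) - b (scaled t x) - ln (\<kappa> (?s t)) - ln (\<tau> (?s t))"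
      using log_edge_density[OF t elim(1)] pos by (simp add: ln_mult)
    then have "- ln (edge_density H i j (scaled t x)) / t \<le>
        (b (scaled t x) * \<rho> (?s t) - a (scaled t x) - b (scaled t x) - ln (\<kappa> (?s t)) - ln (\<tau> (?s t))) / t"
      using elim by (intro divide_right_mono) auto
    then show ?case by (simp only: diff_divide_distrib)
  qed
  ultimately have "block_gauge i j x - block_gauge (Suc i) (j - 1) x - \<alpha> x - \<beta> x
      \<le> \<beta> x * \<rho> (\<alpha> x / \<beta> x) - \<alpha> x - \<beta> x - 0 - 0"
    using log_edge_density_limit[OF x] by (intro tendsto_le[OF trivial_limit_at_top_linorder])
  then show ?thesis by (simp add: edge_gauge_def)
qed

lemma next_left_eq:
  assumes "positive x"
  shows "1 - cond_cdf_left H x i (Suc j) = \<tau> (a x / b x) * exp (b x - b x * \<rho> (a x / b x))"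
  using partial2_copula[OF cdf_bounds[OF assms]] edge
  by (simp add: cond_cdf_left_Suc pair_copula_def a_def b_def)

lemma next_left_bounds:
  assumes "positive x"
  shows "0 < cond_cdf_left H x i (Suc j)" "cond_cdf_left H x i (Suc j) < 1"
proof -
  let ?s = "a x / b x"
  note s = ratio_pos[OF assms]
  have "0 < \<tau> ?s * exp (b x - b x * \<rho> ?s)"
    using intercept_pos[OF s] by simp
  then show "cond_cdf_left H x i (Suc j) < 1"
    unfolding next_left_eq[OF assms, symmetric] by simp
  have "b x * 1 < b x * \<rho> ?s"
    using pickands_gt_1[OF s slope_pos] b_pos[OF assms] by (intro mult_strict_left_mono)
  then have "\<tau> ?s * exp (b x - b x * \<rho> ?s) < 1 * 1"
    using intercept_le_1[OF s] intercept_pos[OF s] by (intro mult_le_less_imp_less) auto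
  then show "0 < cond_cdf_left H x i (Suc j)"
    unfolding next_left_eq[OF assms, symmetric] by simp
qed

lemma next_left_exp_scale:
  assumes "positive x"
  shows "exp_scale (cond_cdf_left H x i (Suc j)) = b x * \<rho> (a x / b x) - b x - ln (\<tau> (a x / b x))"
  unfolding exp_scale_def next_left_eq[OF assms]
  using intercept_pos[OF ratio_pos[OF assms]] by (simp add: ln_mult)

lemma next_left_limit:
  assumes x: "positive x"
  shows "((\<lambda>t. exp_scale (cond_cdf_left H (scaled t x) i (Suc j)) / t) \<longlongrightarrow>
           \<beta> x * \<rho> (\<alpha> x / \<beta> x) - \<beta> x) at_top"
proof -
  let ?s = "\<lambda>t. a (scaled t x) / b (scaled t x)"
  have "((\<lambda>t. b (scaled t x) * \<rho> (?s t) / t - b (scaled t x) / t - ln (\<tau> (?s t)) / t) \<longlongrightarrow>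
      \<beta> x * \<rho> (\<alpha> x / \<beta> x) - \<beta> x - 0) at_top"
    by (intro tendsto_diff scaled_pickands_limit b_limit log_slopes_vanish x slope_pos intercept_pos)
  moreover have "\<forall>\<^sub>F t in at_top. b (scaled t x) * \<rho> (?s t) / t - b (scaled t x) / t - ln (\<tau> (?s t)) / t
      = exp_scale (cond_cdf_left H (scaled t x) i (Suc j)) / t"
    using eventually_gt_at_top[of 0]
    by eventually_elim (simp add: next_left_exp_scale positive_scaled x diff_divide_distrib)
  ultimately show ?thesis by (auto dest: Lim_transform_eventually)
qed

lemma next_right_eq:
  assumes "positive x"
  shows "1 - cond_cdf_right H x (i - 1) j = \<kappa> (a x / b x) * exp (a x - b x * \<rho> (a x / b x))"
  using partial1_copula[OF cdf_bounds[OF assms]] edge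
  by (simp add: cond_cdf_right_Suc pair_copula_def a_def b_def)

lemma next_right_bounds:
  assumes "positive x"
  shows "0 < cond_cdf_right H x (i - 1) j" "cond_cdf_right H x (i - 1) j < 1"
proof -
  let ?s = "a x / b x"
  note s = ratio_pos[OF assms]
  have "0 < \<kappa> ?s * exp (a x - b x * \<rho> ?s)"
    using slope_pos[OF s] by simp
  then show "cond_cdf_right H x (i - 1) j < 1"
    unfolding next_right_eq[OF assms, symmetric] by simp
  have "b x * ?s < b x * \<rho> ?s"
    using pickands_gt_self[OF s intercept_pos] b_pos[OF assms] by (intro mult_strict_left_mono)
  then have "a x < b x * \<rho> ?s"
    using b_pos[OF assms] by simp
  then have "\<kappa> ?s * exp (a x - b x * \<rho> ?s) < 1 * 1"
    using slope_le_1[OF s] slope_pos[OF s] by (intro mult_le_less_imp_less) auto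
  then show "0 < cond_cdf_right H x (i - 1) j"
    unfolding next_right_eq[OF assms, symmetric] by simp
qed

lemma next_right_exp_scale:
  assumes "positive x"
  shows "exp_scale (cond_cdf_right H x (i - 1) j) = b x * \<rho> (a x / b x) - a x - ln (\<kappa> (a x / b x))"
  unfolding exp_scale_def next_right_eq[OF assms]
  using slope_pos[OF ratio_pos[OF assms]] by (simp add: ln_mult)

lemma next_right_limit:
  assumes x: "positive x"
  shows "((\<lambda>t. exp_scale (cond_cdf_right H (scaled t x) (i - 1) j) / t) \<longlongrightarrow>
           \<beta> x * \<rho> (\<alpha> x / \<beta> x) - \<alpha> x) at_top"
proof -
  let ?s = "\<lambda>t. a (scaled t x) / b (scaled t x)"
  have "((\<lambda>t. b (scaled t x) * \<rho> (?s t) / t - a (scaled t x) / t - ln (\<kappa> (?s t)) / t) \<longlongrightarrow>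
      \<beta> x * \<rho> (\<alpha> x / \<beta> x) - \<alpha> x - 0) at_top"
    by (intro tendsto_diff scaled_pickands_limit a_limit log_slopes_vanish x slope_pos intercept_pos)
  moreover have "\<forall>\<^sub>F t in at_top. b (scaled t x) * \<rho> (?s t) / t - a (scaled t x) / t - ln (\<kappa> (?s t)) / t
      = exp_scale (cond_cdf_right H (scaled t x) (i - 1) j) / t"
    using eventually_gt_at_top[of 0]
    by eventually_elim (simp add: next_right_exp_scale positive_scaled x diff_divide_distrib del: One_nat_def)
  ultimately show ?thesis by (auto dest: Lim_transform_eventually)
qed

text \<open>
  Only the first argument of the copula derivative depends on x_i, so the chain rule in
  one variable applies although the copula is only known to have partial derivatives.
\<close>

lemma next_left_derivative:
  assumes "positive x"
  shows "((\<lambda>s. cond_cdf_left H (x(i := s)) i (Suc j)) has_real_derivative cond_density H i (Suc j) x) (at (x i))"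
proof -
  have "cond_cdf_left H (x(i := s)) i (Suc j) =
      partial2 C (cond_cdf_left H (x(i := s)) i j) (cond_cdf_right H x i j)" for s
    using edge cond_cdf_cong(2)[of i j "x(i := s)" x H] by (simp add: cond_cdf_left_Suc pair_copula_def)
  moreover have "((\<lambda>u. partial2 C u (cond_cdf_right H x i j)) has_real_derivative edge_density H i j x)
      (at (cond_cdf_left H (x(i := x i)) i j))"
    using partial2_copula_has_derivative[OF cdf_bounds[OF assms]]
    by (simp add: edge_density_eq[OF assms] a_def b_def)
  moreover have "((\<lambda>s. cond_cdf_left H (x(i := s)) i j) has_real_derivative cond_density H i j x) (at (x i))"
    using left assms by (simp add: left_ok_def)
  ultimately have "((\<lambda>s. cond_cdf_left H (x(i := s)) i (Suc j)) has_real_derivative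
      edge_density H i j x * cond_density H i j x) (at (x i))"
    by (simp only:) (rule DERIV_chain2)
  then show ?thesis
    using edge by (simp add: cond_density_Suc mult.commute)
qed

lemma next_cond_density_nonneg:
  assumes "positive x"
  shows "0 \<le> cond_density H i (Suc j) x"
  using left assms edge edge_density_nonneg[OF assms] by (simp add: left_ok_def cond_density_Suc)

text \<open>
  Suppose that the gauge function of the block is too small at x, hence by continuity also on a segment
  [x_i, q] in direction i. The increment over this segment of the conditional distribution function given
  i+1..j is at most the survival function at x_i, which decays at the rate
  D = A(\<alpha>, \<beta>) - \<beta>. Integrating the
  conditional density over the segment at all integer scales and applying Borel--Cantelli gives a
  point of the segment where the conditional density decays at least at the rate D - \<delta> along the
  integers, which contradicts the size of the gauge function there. Integers suffice because
  the limit along the ray exists.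
\<close>

lemma edge_gauge_le:
  assumes x: "positive x"
  shows "edge_gauge x \<le> block_gauge i j x"
proof (rule ccontr)
  define D where "D = \<beta> x * \<rho> (\<alpha> x / \<beta> x) - \<beta> x"
  define \<delta> where "\<delta> = (edge_gauge x - block_gauge i j x) / 2"
  define y where "y s = x(i := s)" for s
  assume "\<not> edge_gauge x \<le> block_gauge i j x"
  then have \<delta>: "0 < \<delta>"
    by (simp add: \<delta>_def)
  have rest: "block_gauge (Suc i) j (y s) = block_gauge (Suc i) j x" for s
    unfolding y_def by (rule block_gauge_cong) auto
  \<comment> \<open>The defect at x is twice \<delta>; half of it is kept as a margin on the segment.\<close>
  have gap: "block_gauge i j (y (x i)) < block_gauge (Suc i) j x + D - \<delta>"
    using \<delta> by (simp add: \<delta>_def D_def y_def edge_gauge_def right_rate_def field_simps)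
  have x_i: "0 < x i"
    using x by (simp add: positive_def)
  have "continuous_on {0<..} (\<lambda>s. block_gauge i j (y s))"
    unfolding y_def using x edge size by (intro continuous_block_gauge) auto
  then have "isCont (\<lambda>s. block_gauge i j (y s)) (x i)"
    using x_i by (simp add: continuous_on_eq_continuous_at)
  then have "\<forall>\<^sub>F s in at_right (x i). block_gauge i j (y s) < block_gauge (Suc i) j x + D - \<delta>"
    using gap by (intro order_tendstoD(2)) (auto simp: isCont_def filterlim_at_split)
  then obtain q' where q': "x i < q'"
    "\<And>s. x i < s \<Longrightarrow> s < q' \<Longrightarrow> block_gauge i j (y s) < block_gauge (Suc i) j x + D - \<delta>"
    by (auto simp: eventually_at_right_field)
  obtain q where "x i < q" "q < q'"
    using dense[OF q'(1)] by blast
  then have q: "x i < q"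
    "\<And>s. s \<in> {x i..q} \<Longrightarrow> block_gauge i j (y s) < block_gauge (Suc i) j x + D - \<delta>"
    using gap q'(2) by (force simp: le_less)+
  have y_pos: "positive (y s)" if "s \<in> {x i..q}" for s
    using that x_i x by (auto simp: y_def intro: positive_update)

  define N where "N n = real (Suc n)" for n
  define F where "F n s = cond_cdf_left H (scaled (N n) (y s)) i (Suc j)" for n s
  define f where "f n s = N n * cond_density H i (Suc j) (scaled (N n) (y s))" for n s
  \<comment> \<open>The weights undo the decay up to \<delta>, which still leaves a summable geometric bound.\<close>
  define w where "w n = exp (N n * (D - \<delta>))" for n
  have N: "0 < N n" "1 \<le> N n" for n
    by (simp_all add: N_def)
  have N_lim: "filterlim N at_top sequentially"
    unfolding N_def using filterlim_compose[OF filterlim_real_sequentially filterlim_Suc] by simp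
  have F_deriv: "(F n has_real_derivative f n s) (at s)" if "s \<in> {x i..q}" for n s
  proof -
    let ?X = "scaled (N n) (y s)"
    have "((\<lambda>s. N n * s) has_real_derivative N n) (at s)"
      by (auto intro!: derivative_eq_intros)
    moreover have "((\<lambda>r. cond_cdf_left H (?X(i := r)) i (Suc j)) has_real_derivative
        cond_density H i (Suc j) ?X) (at (N n * s))"
      using next_left_derivative[OF positive_scaled[OF y_pos[OF that] N(1)], of n] by (simp add: y_def)
    ultimately have "((\<lambda>r. cond_cdf_left H (?X(i := N n * r)) i (Suc j)) has_real_derivative
        cond_density H i (Suc j) ?X * N n) (at s)"
      using DERIV_chain2[where f = "\<lambda>r. cond_cdf_left H (?X(i := r)) i (Suc j)" and g = "\<lambda>s. N n * s"]
      by blast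
    moreover have "?X(i := N n * r) = scaled (N n) (y r)" for r
      by (auto simp: y_def)
    ultimately show ?thesis
      by (simp add: F_def[abs_def] f_def mult.commute)
  qed
  have f_nonneg: "0 \<le> f n s" if "s \<in> {x i..q}" for n s
    using next_cond_density_nonneg[OF positive_scaled[OF y_pos[OF that] N(1)], of n] N[of n]
    by (simp add: f_def)
  have F_mono: "F n (x i) \<le> F n q" for n
  proof (rule DERIV_nonneg_imp_nondecreasing[of "x i" q "F n"])
    fix s assume "x i \<le> s" "s \<le> q"
    then have "s \<in> {x i..q}" by simp
    then show "\<exists>D. (F n has_real_derivative D) (at s) \<and> 0 \<le> D"
      using F_deriv f_nonneg by blast
  qed (use q(1) in simp)

  have "((\<lambda>n. exp_scale (F n (x i)) / N n) \<longlongrightarrow> D) sequentially"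
    using filterlim_compose[OF next_left_limit[OF x] N_lim]
    by (simp add: F_def y_def D_def)
  then have "\<forall>\<^sub>F n in sequentially. D - \<delta> / 2 < exp_scale (F n (x i)) / N n"
    using \<delta> by (intro order_tendstoD(1)) auto
  then have "\<forall>\<^sub>F n in sequentially. norm (w n * (F n q - F n (x i))) \<le> exp (- (\<delta> / 2)) ^ Suc n"
  proof eventually_elim
    case (elim n)
    have bounds: "F n q < 1" "F n (x i) < 1"
      using q(1) next_left_bounds(2)[OF positive_scaled[OF y_pos N(1)]] by (auto simp: F_def)
    have "N n * (D - \<delta> / 2) < exp_scale (F n (x i))"
      using elim N[of n] by (simp add: less_divide_eq mult.commute)
    moreover have "N n * (D - \<delta>) + N n * (\<delta> / 2) = N n * (D - \<delta> / 2)"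
      by (simp add: field_simps)
    ultimately have exponent: "N n * (D - \<delta>) - exp_scale (F n (x i)) \<le> real (Suc n) * - (\<delta> / 2)"
      unfolding N_def mult_minus_right by linarith
    have "norm (w n * (F n q - F n (x i))) = w n * (F n q - F n (x i))"
      using F_mono[of n] by (simp add: w_def)
    also have "\<dots> \<le> w n * (1 - F n (x i))"
      using bounds by (intro mult_left_mono) (auto simp: w_def)
    also have "\<dots> = exp (N n * (D - \<delta>) - exp_scale (F n (x i)))"
      using bounds by (simp add: one_minus_exp_scale w_def mult_exp_exp)
    also have "\<dots> \<le> exp (real (Suc n) * - (\<delta> / 2))"
      using exponent by simp
    also have "\<dots> = exp (- (\<delta> / 2)) ^ Suc n"
      by (rule exp_of_nat_mult)
    finally show ?case .
  qed
  moreover have "summable (\<lambda>n. exp (- (\<delta> / 2)) ^ Suc n)"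
    using \<delta> by (intro iffD2[OF summable_Suc_iff] summable_geometric) simp
  ultimately have summable: "summable (\<lambda>n. w n * (F n q - F n (x i)))"
    by (rule summable_comparison_test_ev)
  have w: "0 \<le> w n" for n
    by (simp add: w_def)
  have "\<exists>s\<in>{x i..q}. (\<lambda>n. w n * f n s) \<longlonglongrightarrow> 0"
    by (rule derivatives_tend_to_zero_somewhere[where F = F, OF q(1)])
      (fact F_deriv f_nonneg w summable)+
  then obtain s where s: "s \<in> {x i..q}" and lim: "(\<lambda>n. w n * f n s) \<longlonglongrightarrow> 0"
    by blast

  let ?L = "\<lambda>m n t. dvine_density H {m..n} (scaled t (y s))"
  have "\<forall>\<^sub>F t in at_top. 0 < ?L i j t"
    using edge size by (intro block_gauge_limit y_pos s) auto
  moreover have "\<forall>\<^sub>F t in at_top. 0 < ?L (Suc i) j t"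
    by (intro subblock_limit y_pos s) auto
  ultimately have split: "\<forall>\<^sub>F t in at_top. 0 < cond_density H i (Suc j) (scaled t (y s)) \<and>
     - ln (?L i j t) / t - - ln (?L (Suc i) j t) / t = - ln (cond_density H i (Suc j) (scaled t (y s))) / t"
  proof eventually_elim
    case (elim t)
    then show ?case
      using dvine_density_split[of i j H "scaled t (y s)"] edge
      by (auto simp: ln_mult zero_less_mult_iff diff_divide_distrib add_divide_distrib)
  qed
  have "((\<lambda>t. - ln (?L i j t) / t - - ln (?L (Suc i) j t) / t) \<longlongrightarrow>
      block_gauge i j (y s) - block_gauge (Suc i) j (y s)) at_top"
    using edge size by (intro tendsto_diff block_gauge_limit subblock_limit y_pos s) auto
  then have "((\<lambda>t. - ln (cond_density H i (Suc j) (scaled t (y s))) / t) \<longlongrightarrow>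
      block_gauge i j (y s) - block_gauge (Suc i) j (y s)) at_top"
    by (rule Lim_transform_eventually) (use split in \<open>auto elim: eventually_mono\<close>)
  from filterlim_compose[OF this N_lim]
  have "((\<lambda>n. - ln (cond_density H i (Suc j) (scaled (N n) (y s))) / N n) \<longlongrightarrow>
      block_gauge i j (y s) - block_gauge (Suc i) j (y s)) sequentially" .
  moreover have "\<forall>\<^sub>F n in sequentially. D - \<delta> \<le> - ln (cond_density H i (Suc j) (scaled (N n) (y s))) / N n"
  proof -
    have "\<forall>\<^sub>F n in sequentially. 0 < cond_density H i (Suc j) (scaled (N n) (y s))"
      using filterlim_iff[THEN iffD1, OF N_lim, rule_format, OF split] by eventually_elim blast
    moreover have "\<forall>\<^sub>F n in sequentially. w n * f n s < 1"
      using lim by (intro order_tendstoD(2)) auto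
    ultimately show ?thesis
    proof eventually_elim
      case (elim n)
      let ?c = "cond_density H i (Suc j) (scaled (N n) (y s))"
      have "ln (w n * f n s) = N n * (D - \<delta>) + (ln (N n) + ln ?c)"
        using elim N(1)[of n] by (simp add: w_def f_def ln_mult)
      moreover have "ln (w n * f n s) < 0"
        using elim N(1)[of n] by (simp add: w_def f_def)
      moreover have "0 \<le> ln (N n)"
        using N by simp
      ultimately have "N n * (D - \<delta>) \<le> - ln ?c"
        by linarith
      then show ?case by (subst pos_le_divide_eq[OF N(1)]) (simp only: mult.commute)
    qed
  qed
  ultimately have "D - \<delta> \<le> block_gauge i j (y s) - block_gauge (Suc i) j (y s)"
    by (intro tendsto_lowerbound[where F = sequentially]) auto
  then show False
    using q(2)[OF s] rest[of s] by simp
qed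

lemma block_gauge_eq: "positive x \<Longrightarrow> block_gauge i j x = edge_gauge x"
  using block_gauge_le edge_gauge_le by (meson antisym)

lemma next_left_rate:
  assumes "positive x"
  shows "left_rate i (Suc j) x = \<beta> x * \<rho> (\<alpha> x / \<beta> x) - \<beta> x"
  using block_gauge_eq[OF assms] by (simp add: left_rate_def[of i "Suc j"] edge_gauge_def right_rate_def)

lemma next_right_rate:
  assumes "positive x"
  shows "right_rate (i - 1) j x = \<beta> x * \<rho> (\<alpha> x / \<beta> x) - \<alpha> x"
proof -
  have "Suc (i - 1) = i" using edge by simp
  then have "right_rate (i - 1) j x = block_gauge i j x - block_gauge i (j - 1) x"
    by (simp only: right_rate_def)
  then show ?thesis
    using block_gauge_eq[OF assms] by (simp add: edge_gauge_def left_rate_def)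
qed

lemma next_left_ok: "left_ok i (Suc j)"
  unfolding left_ok_def
proof (intro allI impI conjI)
  fix x assume x: "positive x"
  show "0 < cond_cdf_left H x i (Suc j)" "cond_cdf_left H x i (Suc j) < 1"
    "((\<lambda>s. cond_cdf_left H (x(i := s)) i (Suc j)) has_real_derivative cond_density H i (Suc j) x) (at (x i))"
    "0 \<le> cond_density H i (Suc j) x"
    by (rule next_left_bounds[OF x] next_left_derivative[OF x] next_cond_density_nonneg[OF x])+
  show "((\<lambda>t. exp_scale (cond_cdf_left H (scaled t x) i (Suc j)) / t) \<longlongrightarrow> left_rate i (Suc j) x) at_top"
    unfolding next_left_rate[OF x] by (rule next_left_limit[OF x])
  have "\<beta> x * 1 < \<beta> x * \<rho> (\<alpha> x / \<beta> x)"
    using rates_pos[OF x] by (intro mult_strict_left_mono pickands_gt_1 slope_pos)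
  then show "0 < left_rate i (Suc j) x"
    by (simp add: next_left_rate[OF x])
  fix M
  obtain s where s: "0 < s" "M + \<beta> x \<le> \<alpha> (x(i := s))"
    using left x unfolding left_ok_def by metis
  let ?x = "x(i := s)"
  have x': "positive ?x" using positive_update[OF x s(1)] .
  have "\<beta> ?x * (\<alpha> ?x / \<beta> ?x) \<le> \<beta> ?x * \<rho> (\<alpha> ?x / \<beta> ?x)"
    using rates_pos[OF x'] by (intro mult_left_mono pickands_ge) auto
  then have "\<alpha> ?x \<le> \<beta> ?x * \<rho> (\<alpha> ?x / \<beta> ?x)"
    using rates_pos[OF x'] by simp
  then have "M \<le> left_rate i (Suc j) ?x"
    using s(2) rates_update(2)[OF x, of s] by (simp add: next_left_rate[OF x'])
  with s(1) show "\<exists>s>0. M \<le> left_rate i (Suc j) (x(i := s))" by blast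
qed

lemma next_right_ok: "right_ok (i - 1) j"
  unfolding right_ok_def
proof (intro allI impI conjI)
  fix x assume x: "positive x"
  show "0 < cond_cdf_right H x (i - 1) j" "cond_cdf_right H x (i - 1) j < 1"
    by (rule next_right_bounds[OF x])+
  show "((\<lambda>t. exp_scale (cond_cdf_right H (scaled t x) (i - 1) j) / t) \<longlongrightarrow> right_rate (i - 1) j x) at_top"
    unfolding next_right_rate[OF x] by (rule next_right_limit[OF x])
  have "\<beta> x * (\<alpha> x / \<beta> x) < \<beta> x * \<rho> (\<alpha> x / \<beta> x)"
    using rates_pos[OF x] by (intro mult_strict_left_mono pickands_gt_self intercept_pos)
  then show "0 < right_rate (i - 1) j x"
    using rates_pos[OF x] by (simp add: next_right_rate[OF x] del: One_nat_def)
  fix M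
  obtain s where s: "0 < s" "M + \<alpha> x \<le> \<beta> (x(j := s))"
    using right x unfolding right_ok_def by metis
  let ?x = "x(j := s)"
  have x': "positive ?x" using positive_update[OF x s(1)] .
  have "\<beta> ?x * 1 \<le> \<beta> ?x * \<rho> (\<alpha> ?x / \<beta> ?x)"
    using rates_pos[OF x'] by (intro mult_left_mono pickands_ge) auto
  then have "M \<le> right_rate (i - 1) j ?x"
    using s(2) rates_update(1)[OF x, of s] by (simp add: next_right_rate[OF x'] del: One_nat_def)
  with s(1) show "\<exists>s>0. M \<le> right_rate (i - 1) j (x(j := s))" by blast
qed

end

section \<open>The gauge function of the full vine\<close>

context dvine_gauges
begin

text \<open>
  The edge {i, j} receives its first coordinate from the edge {i, j - 1} and its second one from
  {i + 1, j}; both belong to blocks with one coordinate less, for which gauge functions are given.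
\<close>

lemma dvine_edge_holds:
  assumes "0 < k" "1 \<le> i" "i < j" "j \<le> d" "j < Suc (i + k)"
  shows "dvine_edge d H g k i j"
  using assms(2-)
proof (induction "j - i" arbitrary: i j rule: less_induct)
  case less
  have "left_ok i j \<and> right_ok i j"
  proof (cases "j = Suc i")
    case True
    then show ?thesis
      using left_ok_base right_ok_base less.prems assms(1) by auto
  next
    case False
    interpret L: dvine_edge_gauge d H g k i "j - 1"
      using less False by (intro dvine_edge_gauge.intro dvine_edge_gauge_axioms.intro) auto
    interpret R: dvine_edge_gauge d H g k "Suc i" j
      using less False by (intro dvine_edge_gauge.intro dvine_edge_gauge_axioms.intro) auto
    show ?thesis
      using L.next_left_ok R.next_right_ok less.prems by simp
  qed
  then show ?case
    using less.prems by unfold_locales auto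
qed

text \<open>
  The gauge function of a block is a sum of growth rates of conditional survival functions: those of
  each coordinate given its successors in the block.
\<close>

lemma block_gauge_nonneg:
  assumes "0 < k" "positive x" "1 \<le> m" "Suc n \<le> d" "n < m + k"
  shows "0 \<le> block_gauge m n x"
  using assms(3-)
proof (induction "Suc n - m" arbitrary: m)
  case 0
  then show ?case by (simp add: block_gauge_def)
next
  case (Suc l)
  interpret dvine_edge d H g k m "Suc n"
    using Suc.prems Suc.hyps(2) assms(1) by (intro dvine_edge_holds) auto
  have "0 \<le> block_gauge (Suc m) n x"
    using Suc.prems Suc.hyps(2) by (intro Suc.hyps(1)) auto
  then show ?case
    using rates_pos(1)[OF assms(2)] by (simp add: left_rate_def)
qed

end

context dvine_edge
begin

text \<open>
  Here the last edge is treated without a gauge function of its block. The coordinate b tends to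
  infinity, so that the second derivative of the Pickands function, continuous at the limiting
  ratio, disappears from the density factor.
\<close>

lemma density_limit_of_continuous:
  assumes cont: "continuous_on ({0<..<1} \<times> {0<..<1}) (\<lambda>(u, v). copula_density C u v)"
    and density_pos: "\<forall>u\<in>{0<..<1}. \<forall>v\<in>{0<..<1}. copula_density C u v > 0"
    and x: "positive x"
  shows "\<forall>\<^sub>F t in at_top. 0 < dvine_density H {i..j} (scaled t x)"
    and "((\<lambda>t. - ln (dvine_density H {i..j} (scaled t x)) / t) \<longlongrightarrow> edge_gauge x) at_top"
proof -
  let ?s = "\<lambda>t. a (scaled t x) / b (scaled t x)" and ?\<sigma> = "\<alpha> x / \<beta> x"
  let ?D = "\<lambda>t. density_factor (H i j) (?s t) (b (scaled t x))"
  note slope_pos = slope_pos_of_density_pos[OF cont density_pos]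
    and intercept_pos = intercept_pos_of_density_pos[OF cont density_pos]
  note \<sigma> = rates_pos(3)[OF x]
  have edge_pos: "\<forall>\<^sub>F t in at_top. 0 < edge_density H i j (scaled t x)"
    using eventually_gt_at_top[of 0]
    by eventually_elim (use cdf_bounds positive_scaled[OF x] density_pos in
      \<open>auto simp: edge_density_def pair_copula_def\<close>)
  have "((\<lambda>t. \<kappa> (?s t) * \<tau> (?s t) + ?s t * \<kappa>' (?s t) * (1 / t) / (b (scaled t x) / t)) \<longlongrightarrow>
      \<kappa> ?\<sigma> * \<tau> ?\<sigma> + ?\<sigma> * \<kappa>' ?\<sigma> * 0 / \<beta> x) at_top"
    using rates_pos(2)[OF x]
    by (intro tendsto_intros ratio_limit b_limit x
        isCont_tendsto_compose[OF continuous_at_slope[OF \<sigma>]]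
        isCont_tendsto_compose[OF continuous_at_intercept[OF \<sigma>]]
        isCont_tendsto_compose[OF isCont_slope_deriv[OF cont density_pos \<sigma>]]
        tendsto_divide_0[OF tendsto_const] filterlim_at_top_imp_at_infinity filterlim_ident) auto
  moreover have "\<forall>\<^sub>F t in at_top.
      \<kappa> (?s t) * \<tau> (?s t) + ?s t * \<kappa>' (?s t) * (1 / t) / (b (scaled t x) / t) = ?D t"
    using eventually_gt_at_top[of 0] by eventually_elim (simp add: density_factor_def)
  ultimately have "(?D \<longlongrightarrow> \<kappa> ?\<sigma> * \<tau> ?\<sigma>) at_top"
    by (auto dest: Lim_transform_eventually)
  then have "((\<lambda>t. ln (?D t)) \<longlongrightarrow> ln (\<kappa> ?\<sigma> * \<tau> ?\<sigma>)) at_top"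
    using slope_pos[OF \<sigma>] intercept_pos[OF \<sigma>] by (intro tendsto_ln) auto
  then have "((\<lambda>t. ln (?D t) / t) \<longlongrightarrow> 0) at_top"
    by (rule tendsto_divide_0) (simp add: filterlim_at_top_imp_at_infinity filterlim_ident)
  then have "((\<lambda>t. b (scaled t x) * \<rho> (?s t) / t - a (scaled t x) / t - b (scaled t x) / t - ln (?D t) / t)
      \<longlongrightarrow> \<beta> x * \<rho> ?\<sigma> - \<alpha> x - \<beta> x - 0) at_top"
    by (intro tendsto_diff scaled_pickands_limit a_limit b_limit x)
  moreover have "\<forall>\<^sub>F t in at_top.
      b (scaled t x) * \<rho> (?s t) / t - a (scaled t x) / t - b (scaled t x) / t - ln (?D t) / t =
      - ln (edge_density H i j (scaled t x)) / t"
    using eventually_gt_at_top[of 0] edge_pos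
    by eventually_elim (simp only: log_edge_density[OF positive_scaled[OF x]] diff_divide_distrib)
  ultimately have edge_lim: "((\<lambda>t. - ln (edge_density H i j (scaled t x)) / t) \<longlongrightarrow>
      \<beta> x * \<rho> ?\<sigma> - \<alpha> x - \<beta> x - 0) at_top"
    by (rule Lim_transform_eventually)
  have split: "\<forall>\<^sub>F t in at_top. 0 < dvine_density H {i..j} (scaled t x) \<and>
     - ln (dvine_density H {i..j} (scaled t x)) / t =
       - ln (dvine_density H {i..j - 1} (scaled t x)) / t
       + - ln (dvine_density H {Suc i..j} (scaled t x)) / t
       - (- ln (dvine_density H {Suc i..j - 1} (scaled t x)) / t)
       + - ln (edge_density H i j (scaled t x)) / t"
    using log_density_split[OF x] edge_pos by eventually_elim blast
  show "\<forall>\<^sub>F t in at_top. 0 < dvine_density H {i..j} (scaled t x)"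
    using split by eventually_elim blast
  have "((\<lambda>t. - ln (dvine_density H {i..j - 1} (scaled t x)) / t
       + - ln (dvine_density H {Suc i..j} (scaled t x)) / t
       - (- ln (dvine_density H {Suc i..j - 1} (scaled t x)) / t)
       + - ln (edge_density H i j (scaled t x)) / t) \<longlongrightarrow>
     block_gauge i (j - 1) x + block_gauge (Suc i) j x - block_gauge (Suc i) (j - 1) x
       + (\<beta> x * \<rho> ?\<sigma> - \<alpha> x - \<beta> x - 0)) at_top"
    by (intro tendsto_add tendsto_diff subblock_limit x edge_lim) auto
  then have "((\<lambda>t. - ln (dvine_density H {i..j} (scaled t x)) / t) \<longlongrightarrow>
     block_gauge i (j - 1) x + block_gauge (Suc i) j x - block_gauge (Suc i) (j - 1) x
       + (\<beta> x * \<rho> ?\<sigma> - \<alpha> x - \<beta> x - 0)) at_top"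
    by (rule Lim_transform_eventually) (use split in \<open>auto elim: eventually_mono\<close>)
  then show "((\<lambda>t. - ln (dvine_density H {i..j} (scaled t x)) / t) \<longlongrightarrow> edge_gauge x) at_top"
    by (simp add: edge_gauge_def left_rate_def right_rate_def algebra_simps)
qed

lemma edge_gauge_eq:
  "positive x \<Longrightarrow> edge_gauge x = block_gauge (Suc i) (j - 1) x + exponent_measure (H i j) (1 / \<alpha> x) (1 / \<beta> x)"
  using exponent_measure_pickands[OF rates_pos(2), of x "H i j" "\<alpha> x"] by (simp add: edge_gauge_def)

text \<open>
  Strict positivity matters because asymptotic equivalence to 0 is stronger than o(t).
\<close>

lemma edge_gauge_pos:
  assumes "positive x"
  shows "0 < edge_gauge x"
proof -
  have "0 \<le> block_gauge (Suc i) (j - 1) x"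
    using edge assms by (intro block_gauge_nonneg) auto
  moreover have "\<beta> x * 1 \<le> \<beta> x * \<rho> (\<alpha> x / \<beta> x)"
    using rates_pos[OF assms] by (intro mult_left_mono pickands_ge) auto
  ultimately show ?thesis
    using rates_pos(2)[OF assms] unfolding edge_gauge_def by linarith
qed

end

theorem theorem1:
  fixes d :: nat
    and H :: "nat \<Rightarrow> nat \<Rightarrow> real measure"
    and g :: "nat set \<Rightarrow> (nat \<Rightarrow> real) \<Rightarrow> real"
  assumes d: "d \<ge> 4"
    and spectral: "\<And>i j. 1 \<le> i \<Longrightarrow> i < j \<Longrightarrow> j \<le> d \<Longrightarrow> spectral_distribution (H i j)"
    and derivs: "\<And>i j. 1 \<le> i \<Longrightarrow> i < j \<Longrightarrow> j \<le> d \<Longrightarrow> partial12_exist (exponent_measure (H i j))"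
    and gauges: "\<And>m n. 1 \<le> m \<Longrightarrow> m \<le> n \<Longrightarrow> n \<le> d \<Longrightarrow> {m..n} \<noteq> {1..d} \<Longrightarrow>
                   gauge_function {m..n} (dvine_density H {m..n}) (g {m..n})"
    and well_defined: "(\<exists>h. gauge_function {1..d} (dvine_density H {1..d}) h) \<or>
           (continuous_on ({0<..<1} \<times> {0<..<1}) (\<lambda>(u, v). copula_density (pair_copula H 1 d) u v) \<and>
            (\<forall>u\<in>{0<..<1}. \<forall>v\<in>{0<..<1}. copula_density (pair_copula H 1 d) u v > 0))"
  shows "gauge_function {1..d} (dvine_density H {1..d})
           (\<lambda>x. g ({1..d} - {1, d}) (restrict x ({1..d} - {1, d})) +
                exponent_measure (H 1 d)
                  (1 / (g ({1..d} - {d}) (restrict x ({1..d} - {d})) - g ({1..d} - {1, d}) (restrict x ({1..d} - {1, d}))))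
                  (1 / (g ({1..d} - {1}) (restrict x ({1..d} - {1})) - g ({1..d} - {1, d}) (restrict x ({1..d} - {1, d})))))"
proof -
  have sets: "{1..d} - {1, d} = {Suc 1..d - 1}" "{1..d} - {d} = {1..d - 1}" "{1..d} - {1} = {Suc 1..d}"
    using d by auto
  define \<gamma> where "\<gamma> m n x = g {m..n} (restrict x {m..n})" for m n x
  define G where "G x = \<gamma> (Suc 1) (d - 1) x + exponent_measure (H 1 d)
      (1 / (\<gamma> 1 (d - 1) x - \<gamma> (Suc 1) (d - 1) x)) (1 / (\<gamma> (Suc 1) d x - \<gamma> (Suc 1) (d - 1) x))" for x
  interpret H1d: spectral_measure "H 1 d"
    using spectral[of 1 d] d by unfold_locales auto

  have block: "gauge_function {m..n} (dvine_density H {m..n}) (g {m..n})" "{m..n} \<subseteq> {1..d}"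
    if "(m, n) \<in> {(1, d - 1), (Suc 1, d), (Suc 1, d - 1)}" for m n
    using that d gauges[of m n] by auto
  have homogeneous: "\<gamma> m n (\<lambda>i\<in>{1..d}. t * x i) = t * \<gamma> m n x"
    if "(m, n) \<in> {(1, d - 1), (Suc 1, d), (Suc 1, d - 1)}" "x \<in> {1..d} \<rightarrow>\<^sub>E {0..}" "0 < t" for m n x t
  proof -
    have "restrict (\<lambda>i\<in>{1..d}. t * x i) {m..n} = (\<lambda>i\<in>{m..n}. t * restrict x {m..n} i)"
      using block(2)[OF that(1)] by (auto simp: restrict_def fun_eq_iff)
    moreover have "restrict x {m..n} \<in> {m..n} \<rightarrow>\<^sub>E {0..}"
      using block(2)[OF that(1)] that(2) by auto
    ultimately show ?thesis
      using block(1)[OF that(1)] that(3) unfolding gauge_function_def \<gamma>_def by metis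
  qed
  have continuous: "continuous_on ({1..d} \<rightarrow>\<^sub>E {0..}) (\<gamma> m n)"
    if "(m, n) \<in> {(1, d - 1), (Suc 1, d), (Suc 1, d - 1)}" for m n
  proof -
    have "continuous_on ({1..d} \<rightarrow>\<^sub>E {0..}) (\<lambda>x :: nat \<Rightarrow> real. restrict x {m..n})"
    proof (rule continuous_on_coordinatewise_then_product)
      fix k
      show "continuous_on ({1..d} \<rightarrow>\<^sub>E {0..}) (\<lambda>x :: nat \<Rightarrow> real. restrict x {m..n} k)"
        by (cases "k \<in> {m..n}") (auto intro!: continuous_on_product_coordinates continuous_on_subset[OF continuous_on_product_coordinates])
    qed
    moreover have "continuous_on ({m..n} \<rightarrow>\<^sub>E {0..}) (g {m..n})"
      using block(1)[OF that] by (simp add: gauge_function_def)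
    moreover have "(\<lambda>x. restrict x {m..n}) ` ({1..d} \<rightarrow>\<^sub>E {0..}) \<subseteq> {m..n} \<rightarrow>\<^sub>E {0..}"
      using block(2)[OF that] by auto
    ultimately show ?thesis
      unfolding \<gamma>_def[abs_def] using continuous_on_compose2 by blast
  qed

  have limit: "(\<forall>\<^sub>F t in at_top. 0 < dvine_density H {1..d} (scaled t x)) \<and>
      ((\<lambda>t. - ln (dvine_density H {1..d} (scaled t x)) / t) \<longlongrightarrow> G x) at_top \<and> 0 < G x"
    if x: "positive x" for x
    using well_defined
  proof
    assume "\<exists>h. gauge_function {1..d} (dvine_density H {1..d}) h"
    then obtain h where h: "gauge_function {1..d} (dvine_density H {1..d}) h" ..
    \<comment> \<open>The given gauge function h completes the family, and the recursion at the last edge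
      identifies it on the open orthant.\<close>
    interpret dvine_gauges d H "g({1..d} := h)" d
    proof (unfold_locales)
      fix m n :: nat
      assume "1 \<le> m" "m \<le> n" "n \<le> d"
      then show "gauge_function {m..n} (dvine_density H {m..n}) ((g({1..d} := h)) {m..n})"
        using gauges h by simp
    qed (use spectral derivs in auto)
    interpret dvine_edge d H "g({1..d} := h)" d 1 d
      using d by (intro dvine_edge_holds) auto
    interpret dvine_edge_gauge d H "g({1..d} := h)" d 1 d
      by unfold_locales simp
    have "{Suc 1..d - 1} \<noteq> {1..d}" "{1..d - 1} \<noteq> {1..d}" "{Suc 1..d} \<noteq> {1..d}"
      using sets d by auto
    then have "edge_gauge x = G x"
      unfolding edge_gauge_eq[OF x] left_rate_def right_rate_def block_gauge_def G_def \<gamma>_def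
      using d by auto
    then show ?thesis
      using block_gauge_limit[OF x, of 1 d] block_gauge_eq[OF x] edge_gauge_pos[OF x] by simp
  next
    assume density: "continuous_on ({0<..<1} \<times> {0<..<1}) (\<lambda>(u, v). copula_density (pair_copula H 1 d) u v) \<and>
        (\<forall>u\<in>{0<..<1}. \<forall>v\<in>{0<..<1}. copula_density (pair_copula H 1 d) u v > 0)"
    interpret dvine_gauges d H g "d - 1"
    proof (unfold_locales)
      fix m n :: nat
      assume "1 \<le> m" "m \<le> n" "n \<le> d" "n - m < d - 1"
      then show "gauge_function {m..n} (dvine_density H {m..n}) (g {m..n})"
        using d by (intro gauges) (auto simp: Icc_eq_Icc)
    qed (use spectral derivs in auto)
    interpret dvine_edge d H g "d - 1" 1 d
      using d by (intro dvine_edge_holds) auto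
    have "edge_gauge x = G x"
      unfolding edge_gauge_eq[OF x] left_rate_def right_rate_def block_gauge_def G_def \<gamma>_def
      using d by auto
    then show ?thesis
      using density_limit_of_continuous[OF _ _ x] density edge_gauge_pos[OF x]
      by (simp add: pair_copula_def)
  qed

  have "gauge_function {1..d} (dvine_density H {1..d}) G"
    unfolding gauge_function_def
  proof (intro conjI ballI allI impI)
    fix x :: "nat \<Rightarrow> real" and t :: real
    assume "x \<in> {1..d} \<rightarrow>\<^sub>E {0..}" "0 < t"
    then show "G (\<lambda>i\<in>{1..d}. t * x i) = t * G x"
      using exponent_measure_homogeneous[of t "H 1 d"]
      by (simp add: G_def homogeneous right_diff_distrib[symmetric] distrib_left del: One_nat_def)
  next
    show "continuous_on ({1..d} \<rightarrow>\<^sub>E {0..}) G"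
      unfolding G_def[abs_def]
      by (intro continuous_on_add H1d.continuous_on_exponent_measure continuous_on_diff continuous) auto
  next
    fix x :: "nat \<Rightarrow> real"
    assume x: "x \<in> {1..d} \<rightarrow>\<^sub>E {0<..}"
    \<comment> \<open>Outside the block any positive value will do.\<close>
    define x' where "x' k = (if k \<in> {1..d} then x k else 1)" for k
    have "positive x'"
      using x by (auto simp: positive_def x'_def)
    note lim = limit[OF this]
    have f: "dvine_density H {1..d} (scaled t x') = dvine_density H {1..d} (\<lambda>i\<in>{1..d}. t * x i)" for t
      by (rule dvine_density_cong) (simp add: x'_def)
    have "\<gamma> m n x' = \<gamma> m n x" if "(m, n) \<in> {(1, d - 1), (Suc 1, d), (Suc 1, d - 1)}" for m n
    proof -
      have "restrict x' {m..n} = restrict x {m..n}"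
        using block(2)[OF that] by (auto simp: x'_def restrict_def fun_eq_iff)
      then show ?thesis by (simp add: \<gamma>_def)
    qed
    then have G: "G x' = G x"
      unfolding G_def by simp
    show "\<forall>\<^sub>F t in at_top. 0 < dvine_density H {1..d} (\<lambda>i\<in>{1..d}. t * x i)"
      using lim unfolding f by blast
    show "(\<lambda>t. - ln (dvine_density H {1..d} (\<lambda>i\<in>{1..d}. t * x i))) \<sim>[at_top] (\<lambda>t. t * G x)"
      using lim unfolding f G by (subst asymp_equiv_linear_iff) auto
  qed
  then show ?thesis
    unfolding sets G_def[abs_def] \<gamma>_def .
qed

end
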